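(* Let $\underline{\omega}=(\omega_1,\omega_2)\in\mathbb{R}_+^2$ be a generic irrational ordered pair, and let $\Lambda>0$, $\tau>1$. Consider, for either choice of sign $\pm$, the quasi-resonant cubic nonlinear Schrödinger initial value problem $$ i\partial_t\psi=\Delta\psi\pm(|\psi|^2\psi)^*,\quad x\in\mathbb{T}^2_{\underline{\omega}},\ t\in\mathbb{R},\qquad \psi(0)=\psi_0, $$ where $(|\psi|^2\psi)^*$ denotes the cubic nonlinearity restricted to $(\Lambda,\tau)$-quasi-resonant interactions. If the initial datum $\psi_0$ has compact support in frequency space (i.e. only finitely many Fourier coefficients of $\psi_0$ are nonzero), then for any $s>1$ the $H^s$ norm of the associated global solution is uniformly bounded in time, that is, $\sup_{t}\|\psi(t)\|_{H^s(\mathbb{T}^2_{\underline{\omega}})}<\infty$.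
   Context: $\mathbb{T}^2_{\underline{\omega}}=\mathbb{R}/\omega_1\mathbb{Z}\times\mathbb{R}/\omega_2\mathbb{Z}$ is the flat torus. For $k=(m,\ell)\in\mathbb{Z}^2$ write $\hat\psi_k$ for the coefficient of $e^{2\pi i(m x_1/\omega_1+\ell x_2/\omega_2)}$ in the Fourier series of $\psi$, and let $\lambda_k=4\pi^2(m^2/\omega_1^2+\ell^2/\omega_2^2)$ be the corresponding eigenvalue of $-\Delta$. $H^s$ is the $L^2$-based Sobolev space, with norm (up to equivalence) $\big(\sum_k |\hat\psi_k|^2(1+|k|^2)^{s}\big)^{1/2}$. Generic irrational ordered pair: $\alpha=\omega_1^2/\omega_2^2$ is irrational and is not well-approximated by rationals, in the sense that for every $C>0$ and every $\sigma>0$ there are only finitely many $(p,q)\in\mathbb{Z}\times\mathbb{Z}_+$ with $|p/q-\alpha|\le C/q^{2+\sigma}$ (such $\alpha$ form a full-measure set). $(\Lambda,\tau)$-quasi-resonant quartet: $(k_1,k_2,k_3,k_4)\in(\mathbb{Z}^2)^4$ with $k_1+k_2-k_3-k_4=0$ and $$|\lambda_{k_1}+\lambda_{k_2}-\lambda_{k_3}-\lambda_{k_4}|\le\frac{\Lambda}{(|k_1|^2+|k_2|^2+|k_3|^2+|k_4|^2)^{1+\tau}},$$ where the quartet with all $k_i=0$ is counted as quasi-resonant. The restricted nonlinearity is defined by $$\widehat{\big((|\psi|^2\psi)^*\big)}_k=\sum \hat\psi_{k_1}\hat\psi_{k_2}\overline{\hat\psi_{k_3}},$$ the sum being over $(k_1,k_2,k_3)$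 such that $(k_1,k_2,k_3,k)$ is a $(\Lambda,\tau)$-quasi-resonant quartet. The associated global solution is the unique solution in $C(\mathbb{R};L^2(\mathbb{T}^2_{\underline{\omega}}))$ with initial datum $\psi_0$, the equation being understood in the Duhamel sense (equivalently coefficientwise in Fourier space); the problem is globally well-posed in $L^2$. *)

theory Defs
  imports "HOL-Analysis.Analysis"
begin

type_synonym freq = "int \<times> int"

definition freq_sq :: "freq \<Rightarrow> real" where
  "freq_sq k = (real_of_int (fst k))\<^sup>2 + (real_of_int (snd k))\<^sup>2"

definition eigenval :: "real \<Rightarrow> real \<Rightarrow> freq \<Rightarrow> real" where
  "eigenval \<omega>\<^sub>1 \<omega>\<^sub>2 k =
     4 * pi\<^sup>2 * ((real_of_int (fst k))\<^sup>2 / \<omega>\<^sub>1\<^sup>2 + (real_of_int (snd k))\<^sup>2 / \<omega>\<^sub>2\<^sup>2)"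

definition generic_irrational_pair :: "real \<Rightarrow> real \<Rightarrow> bool" where
  "generic_irrational_pair \<omega>\<^sub>1 \<omega>\<^sub>2 \<longleftrightarrow>
     0 < \<omega>\<^sub>1 \<and> 0 < \<omega>\<^sub>2 \<and>
     \<omega>\<^sub>1\<^sup>2 / \<omega>\<^sub>2\<^sup>2 \<notin> \<rat> \<and>
     (\<forall>C>0. \<forall>\<sigma>>0.
        finite {(p, q). q > (0::int) \<and>
          \<bar>real_of_int p / real_of_int q - \<omega>\<^sub>1\<^sup>2 / \<omega>\<^sub>2\<^sup>2\<bar>
            \<le> C / real_of_int q powr (2 + \<sigma>)})"

definition quasi_resonant ::
  "real \<Rightarrow> real \<Rightarrow> real \<Rightarrow> real \<Rightarrow> freq \<Rightarrow> freq \<Rightarrow> freq \<Rightarrow> freq \<Rightarrow> bool" where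
  "quasi_resonant \<omega>\<^sub>1 \<omega>\<^sub>2 \<Lambda> \<tau> k1 k2 k3 k4 \<longleftrightarrow>
     k1 + k2 - k3 - k4 = 0 \<and>
     (k1 = 0 \<and> k2 = 0 \<and> k3 = 0 \<and> k4 = 0 \<or>
      \<bar>eigenval \<omega>\<^sub>1 \<omega>\<^sub>2 k1 + eigenval \<omega>\<^sub>1 \<omega>\<^sub>2 k2 - eigenval \<omega>\<^sub>1 \<omega>\<^sub>2 k3 - eigenval \<omega>\<^sub>1 \<omega>\<^sub>2 k4\<bar>
        \<le> \<Lambda> / (freq_sq k1 + freq_sq k2 + freq_sq k3 + freq_sq k4) powr (1 + \<tau>))"

text \<open>The flat torus is represented by its half-open fundamental rectangle with Lebesgue measure;
  functions on the torus are functions on the plane of which only the values on this rectangle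
  matter, and elements of the L2 space are such functions up to almost everywhere equality.\<close>

definition torus :: "real \<Rightarrow> real \<Rightarrow> (real \<times> real) measure" where
  "torus \<omega>\<^sub>1 \<omega>\<^sub>2 = restrict_space lborel ({0..<\<omega>\<^sub>1} \<times> {0..<\<omega>\<^sub>2})"

definition L2_torus :: "real \<Rightarrow> real \<Rightarrow> (real \<times> real \<Rightarrow> complex) set" where
  "L2_torus \<omega>\<^sub>1 \<omega>\<^sub>2 =
     {f \<in> borel_measurable (torus \<omega>\<^sub>1 \<omega>\<^sub>2). integrable (torus \<omega>\<^sub>1 \<omega>\<^sub>2) (\<lambda>x. (cmod (f x))\<^sup>2)}"

definition L2_dist :: "real \<Rightarrow> real \<Rightarrow> (real \<times> real \<Rightarrow> complex) \<Rightarrow> (real \<times> real \<Rightarrow> complex) \<Rightarrow> real" where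
  "L2_dist \<omega>\<^sub>1 \<omega>\<^sub>2 f g = sqrt (LINT x|torus \<omega>\<^sub>1 \<omega>\<^sub>2. (cmod (f x - g x))\<^sup>2)"

definition fourier_coeff :: "real \<Rightarrow> real \<Rightarrow> (real \<times> real \<Rightarrow> complex) \<Rightarrow> freq \<Rightarrow> complex" where
  "fourier_coeff \<omega>\<^sub>1 \<omega>\<^sub>2 f k =
     (LINT x|torus \<omega>\<^sub>1 \<omega>\<^sub>2.
        f x * cis (- 2 * pi * (real_of_int (fst k) * fst x / \<omega>\<^sub>1 + real_of_int (snd k) * snd x / \<omega>\<^sub>2)))
     / complex_of_real (\<omega>\<^sub>1 * \<omega>\<^sub>2)"

definition sobolev_space :: "real \<Rightarrow> real \<Rightarrow> real \<Rightarrow> (real \<times> real \<Rightarrow> complex) set" where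
  "sobolev_space \<omega>\<^sub>1 \<omega>\<^sub>2 s =
     {f \<in> L2_torus \<omega>\<^sub>1 \<omega>\<^sub>2.
        (\<lambda>k. (cmod (fourier_coeff \<omega>\<^sub>1 \<omega>\<^sub>2 f k))\<^sup>2 * (1 + freq_sq k) powr s) summable_on UNIV}"

text \<open>Only meaningful on \<^const>\<open>sobolev_space\<close>: an infinite sum that diverges
  has the value 0 in the library.\<close>

definition sobolev_norm :: "real \<Rightarrow> real \<Rightarrow> real \<Rightarrow> (real \<times> real \<Rightarrow> complex) \<Rightarrow> real" where
  "sobolev_norm \<omega>\<^sub>1 \<omega>\<^sub>2 s f =
     sqrt (\<Sum>\<^sub>\<infinity>k. (cmod (fourier_coeff \<omega>\<^sub>1 \<omega>\<^sub>2 f k))\<^sup>2 * (1 + freq_sq k) powr s)"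

definition restricted_cubic_coeff ::
  "real \<Rightarrow> real \<Rightarrow> real \<Rightarrow> real \<Rightarrow> (real \<times> real \<Rightarrow> complex) \<Rightarrow> freq \<Rightarrow> complex" where
  "restricted_cubic_coeff \<omega>\<^sub>1 \<omega>\<^sub>2 \<Lambda> \<tau> f k =
     (\<Sum>\<^sub>\<infinity>(k1, k2, k3)\<in>{(k1, k2, k3). quasi_resonant \<omega>\<^sub>1 \<omega>\<^sub>2 \<Lambda> \<tau> k1 k2 k3 k}.
        fourier_coeff \<omega>\<^sub>1 \<omega>\<^sub>2 f k1 * fourier_coeff \<omega>\<^sub>1 \<omega>\<^sub>2 f k2 * cnj (fourier_coeff \<omega>\<^sub>1 \<omega>\<^sub>2 f k3))"

text \<open>A global solution, continuous in time with values in L2, of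
  i d/dt psi = Laplacian psi + \<epsilon> (|psi|^2 psi)^*, in the Duhamel sense. On the k-th Fourier mode
  the Laplacian acts as multiplication by minus the eigenvalue, so the linear flow is
  multiplication by cis (eigenvalue * t); the integral is oriented, so negative times are
  covered.\<close>

definition is_global_solution ::
  "real \<Rightarrow> real \<Rightarrow> real \<Rightarrow> real \<Rightarrow> real \<Rightarrow> (real \<times> real \<Rightarrow> complex)
     \<Rightarrow> (real \<Rightarrow> real \<times> real \<Rightarrow> complex) \<Rightarrow> bool" where
  "is_global_solution \<omega>\<^sub>1 \<omega>\<^sub>2 \<Lambda> \<tau> \<epsilon> \<psi>\<^sub>0 \<psi> \<longleftrightarrow>
     (\<forall>t. \<psi> t \<in> L2_torus \<omega>\<^sub>1 \<omega>\<^sub>2) \<and>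
     (\<forall>t\<^sub>0. ((\<lambda>t. L2_dist \<omega>\<^sub>1 \<omega>\<^sub>2 (\<psi> t) (\<psi> t\<^sub>0)) \<longlongrightarrow> 0) (at t\<^sub>0)) \<and>
     (AE x in torus \<omega>\<^sub>1 \<omega>\<^sub>2. \<psi> 0 x = \<psi>\<^sub>0 x) \<and>
     (\<forall>t k. fourier_coeff \<omega>\<^sub>1 \<omega>\<^sub>2 (\<psi> t) k =
        cis (eigenval \<omega>\<^sub>1 \<omega>\<^sub>2 k * t) * fourier_coeff \<omega>\<^sub>1 \<omega>\<^sub>2 \<psi>\<^sub>0 k
        - \<i> * complex_of_real \<epsilon> *
          (LBINT u=ereal 0..ereal t. cis (eigenval \<omega>\<^sub>1 \<omega>\<^sub>2 k * (t - u)) *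
             restricted_cubic_coeff \<omega>\<^sub>1 \<omega>\<^sub>2 \<Lambda> \<tau> (\<psi> u) k))"

end

theory Submission
  imports Defs
begin

text \<open>
  The eigenvalue combination of a quartet equals, up to a constant, \<open>a + b \<alpha>\<close> with integers
  \<open>a\<close>, \<open>b\<close> and \<open>\<alpha>\<close> the squared ratio of the periods, and \<open>b\<close> is bounded by the size of the quartet.
  Quasi-resonance makes it so small that the Diophantine condition forces \<open>a = b = 0\<close> for all
  large quartets. The two coordinates then decouple, and one-dimensional exact resonances are
  trivial, so a large quasi-resonant quartet is an axis-parallel rectangle.

  A rectangle with a corner in a row \<open>m\<close> of the frequency lattice has a second corner among the
  other factors of the cubic term that lies in the same row. Hence for \<open>\<bar>m\<bar>\<close> large the
  l2 norm of the row obeys a closed Gronwall inequality and stays 0 if it is 0 initially; likewise for columns.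
  The solution therefore lives in a fixed finite box of frequencies, where conservation of mass
  bounds every Sobolev norm.
\<close>

subsection \<open>Large quasi-resonant quartets\<close>

text \<open>Triviality of one-dimensional exact resonances: inserting \<open>b = c + d - a\<close>
  turns the identity of squares into \<open>2 * (a - c) * (a - d) = 0\<close>.\<close>

lemma sum_eq_sum_squares_eq_cases:
  fixes a b c d :: int
  assumes "a + b = c + d" and "a\<^sup>2 + b\<^sup>2 = c\<^sup>2 + d\<^sup>2"
  shows "a = c \<and> b = d \<or> a = d \<and> b = c"
proof -
  have b: "b = c + d - a" using assms(1) by simp
  have "(a - c) * (a - d) = 0"
    using assms(2) unfolding b by (simp add: power2_eq_square algebra_simps)
  then show ?thesis using b by auto
qed

text \<open>The Diophantine condition is applied with \<sigma> = \<tau>. It leaves finitely many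
  fractions that approximate \<alpha> too well, and irrationality keeps each of these at a positive
  distance; their minimum \<delta> exceeds the resonance defect of every large quartet.\<close>

lemma quasi_resonant_imp_squares_eq:
  assumes gen: "generic_irrational_pair \<omega>\<^sub>1 \<omega>\<^sub>2" and "\<Lambda> > 0" and "\<tau> > 0"
  obtains N where "\<And>k1 k2 k3 k4. quasi_resonant \<omega>\<^sub>1 \<omega>\<^sub>2 \<Lambda> \<tau> k1 k2 k3 k4 \<Longrightarrow>
      freq_sq k1 + freq_sq k2 + freq_sq k3 + freq_sq k4 > N \<Longrightarrow>
      (fst k1)\<^sup>2 + (fst k2)\<^sup>2 = (fst k3)\<^sup>2 + (fst k4)\<^sup>2 \<and>
      (snd k1)\<^sup>2 + (snd k2)\<^sup>2 = (snd k3)\<^sup>2 + (snd k4)\<^sup>2"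
proof -
  define \<alpha> where "\<alpha> = \<omega>\<^sub>1\<^sup>2 / \<omega>\<^sub>2\<^sup>2"
  \<comment> \<open>\<Lambda> divided by the factor
    \<open>4 * pi\<^sup>2 / \<omega>\<^sub>1\<^sup>2\<close> that is pulled out of the eigenvalue
    combination in \<open>eig\<close>.\<close>
  define C where "C = \<Lambda> * \<omega>\<^sub>1\<^sup>2 / (4 * pi\<^sup>2)"
  have pos: "\<omega>\<^sub>1 > 0" "\<omega>\<^sub>2 > 0" and irr: "\<alpha> \<notin> \<rat>"
    using gen by (auto simp: generic_irrational_pair_def \<alpha>_def)
  have C: "C > 0" unfolding C_def using assms pos by simp
  define A where "A = {(p, q). q > (0::int) \<and>
          \<bar>real_of_int p / real_of_int q - \<alpha>\<bar> \<le> C / real_of_int q powr (2 + \<tau>)}"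
  have finA: "finite A"
    using gen C \<open>\<tau> > 0\<close> unfolding generic_irrational_pair_def A_def \<alpha>_def by blast
  \<comment> \<open>The element 1 serves the case \<open>b = 0\<close>, where a nonzero integer
    \<open>a\<close> has modulus at least 1; it also makes the minimum meaningful when
    \<open>A\<close> is empty.\<close>
  define D where "D = insert 1 ((\<lambda>(p, q). \<bar>real_of_int p - \<alpha> * real_of_int q\<bar>) ` A)"
  have D_pos: "d > 0" if "d \<in> D" for d
  proof -
    have "real_of_int p - \<alpha> * real_of_int q \<noteq> 0" if "q > 0" for p q :: int
    proof
      assume "real_of_int p - \<alpha> * real_of_int q = 0"
      then have "\<alpha> = real_of_int p / real_of_int q" using that by (simp add: field_simps)
      then show False using irr by simp
    qed
    then show ?thesis using that by (auto simp: D_def A_def)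
  qed
  define \<delta> where "\<delta> = Min D"
  have finD: "finite D" using finA by (simp add: D_def)
  have "\<delta> > 0" unfolding \<delta>_def using finD D_pos by (subst Min_gr_iff) (auto simp: D_def)
  have \<delta>_le: "\<delta> \<le> d" if "d \<in> D" for d using that finD by (simp add: \<delta>_def)
  \<comment> \<open>A size above 1 excludes the zero quartet, which is quasi-resonant by convention,
    and makes the size at most its power \<open>1 + \<tau>\<close>. A size above
    \<open>C / \<delta>\<close> then pushes the defect below \<delta>.\<close>
  show ?thesis
  proof (rule that[of "max 1 (C / \<delta>)"])
    fix k1 k2 k3 k4
    assume qr: "quasi_resonant \<omega>\<^sub>1 \<omega>\<^sub>2 \<Lambda> \<tau> k1 k2 k3 k4"
      and big: "freq_sq k1 + freq_sq k2 + freq_sq k3 + freq_sq k4 > max 1 (C / \<delta>)"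
    define N where "N = freq_sq k1 + freq_sq k2 + freq_sq k3 + freq_sq k4"
    define a where "a = (fst k1)\<^sup>2 + (fst k2)\<^sup>2 - (fst k3)\<^sup>2 - (fst k4)\<^sup>2"
    define b where "b = (snd k1)\<^sup>2 + (snd k2)\<^sup>2 - (snd k3)\<^sup>2 - (snd k4)\<^sup>2"
    have N: "N > 1" "N > C / \<delta>" using big by (auto simp: N_def)
    have eig: "eigenval \<omega>\<^sub>1 \<omega>\<^sub>2 k1 + eigenval \<omega>\<^sub>1 \<omega>\<^sub>2 k2 - eigenval \<omega>\<^sub>1 \<omega>\<^sub>2 k3 - eigenval \<omega>\<^sub>1 \<omega>\<^sub>2 k4
        = 4 * pi\<^sup>2 / \<omega>\<^sub>1\<^sup>2 * (real_of_int a + \<alpha> * real_of_int b)"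
    proof -
      have "4 * pi\<^sup>2 / \<omega>\<^sub>1\<^sup>2 * (real_of_int a + \<alpha> * real_of_int b)
          = 4 * pi\<^sup>2 * (real_of_int a / \<omega>\<^sub>1\<^sup>2 + real_of_int b / \<omega>\<^sub>2\<^sup>2)"
        using pos unfolding \<alpha>_def by (simp add: field_simps)
      then show ?thesis
        unfolding eigenval_def a_def b_def
        by (simp add: add_divide_distrib diff_divide_distrib algebra_simps)
    qed
    have "\<not> (k1 = 0 \<and> k2 = 0 \<and> k3 = 0 \<and> k4 = 0)"
      using N(1) by (auto simp: N_def freq_sq_def)
    then have "\<bar>4 * pi\<^sup>2 / \<omega>\<^sub>1\<^sup>2 * (real_of_int a + \<alpha> * real_of_int b)\<bar> \<le> \<Lambda> / N powr (1 + \<tau>)"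
      using qr unfolding quasi_resonant_def eig N_def by blast
    then have "4 * pi\<^sup>2 / \<omega>\<^sub>1\<^sup>2 * \<bar>real_of_int a + \<alpha> * real_of_int b\<bar> \<le> \<Lambda> / N powr (1 + \<tau>)"
      by (simp add: abs_mult)
    then have ab: "\<bar>real_of_int a + \<alpha> * real_of_int b\<bar> \<le> C / N powr (1 + \<tau>)"
      using pos N(1) unfolding C_def by (simp add: field_simps)
    have "N powr 1 \<le> N powr (1 + \<tau>)" using N(1) \<open>\<tau> > 0\<close> by (intro powr_mono) auto
    then have "C / \<delta> < N powr (1 + \<tau>)" using N by simp
    then have small: "C / N powr (1 + \<tau>) < \<delta>"
      using \<open>\<delta> > 0\<close> N(1) by (simp add: field_simps)
    have "b = 0"
    proof (rule ccontr)
      assume "b \<noteq> 0"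
      \<comment> \<open>The sign of \<open>b\<close> is moved into the numerator, so that the
        denominator is positive as the Diophantine condition demands.\<close>
      define q where "q = \<bar>b\<bar>"
      define p where "p = - sgn b * a"
      have q: "q > 0" using \<open>b \<noteq> 0\<close> by (simp add: q_def)
      have pq: "\<bar>real_of_int p - \<alpha> * real_of_int q\<bar> = \<bar>real_of_int a + \<alpha> * real_of_int b\<bar>"
        unfolding p_def q_def by (cases "b > 0") (use \<open>b \<noteq> 0\<close> in auto)
      have "real_of_int q = \<bar>(real_of_int (snd k1))\<^sup>2 + (real_of_int (snd k2))\<^sup>2
          - (real_of_int (snd k3))\<^sup>2 - (real_of_int (snd k4))\<^sup>2\<bar>"
        unfolding q_def b_def by simp
      also have "\<dots> \<le> N"
        unfolding N_def freq_sq_def abs_le_iff by (simp add: algebra_simps)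
      finally have "real_of_int q powr (1 + \<tau>) \<le> N powr (1 + \<tau>)"
        using q \<open>\<tau> > 0\<close> by (intro powr_mono2) auto
      then have "C / N powr (1 + \<tau>) \<le> C / real_of_int q powr (1 + \<tau>)"
        using C q N by (intro divide_left_mono) auto
      \<comment> \<open>Dividing by \<open>q\<close> raises the exponent from
        \<open>1 + \<tau>\<close> to \<open>2 + \<tau>\<close>. The pair therefore belongs to
        \<open>A\<close>, and its distance is at least \<delta>, against
        \<open>small\<close>.\<close>
      then have "\<bar>real_of_int p - \<alpha> * real_of_int q\<bar> / q \<le> C / real_of_int q powr (1 + \<tau>) / q"
        using ab pq q by (intro divide_right_mono) auto
      also have "\<dots> = C / real_of_int q powr (2 + \<tau>)"
        using q powr_add[of "real_of_int q" 1 "1 + \<tau>"] by simp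
      also have "\<bar>real_of_int p - \<alpha> * real_of_int q\<bar> / q = \<bar>real_of_int p / q - \<alpha>\<bar>"
        using q abs_divide[of "real_of_int p - \<alpha> * real_of_int q" "real_of_int q"]
        by (simp add: diff_divide_distrib)
      finally have "(p, q) \<in> A" using q by (simp add: A_def)
      then have "\<delta> \<le> \<bar>real_of_int p - \<alpha> * real_of_int q\<bar>" by (intro \<delta>_le) (auto simp: D_def)
      then show False using ab pq small by simp
    qed
    moreover have "a = 0"
    proof (rule ccontr)
      assume "a \<noteq> 0"
      then have "1 \<le> \<bar>real_of_int a\<bar>" by linarith
      moreover have "\<delta> \<le> 1" by (intro \<delta>_le) (simp add: D_def)
      ultimately show False using ab small \<open>b = 0\<close> by simp
    qed
    ultimately show "(fst k1)\<^sup>2 + (fst k2)\<^sup>2 = (fst k3)\<^sup>2 + (fst k4)\<^sup>2 \<and>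
      (snd k1)\<^sup>2 + (snd k2)\<^sup>2 = (snd k3)\<^sup>2 + (snd k4)\<^sup>2"
      by (simp add: a_def b_def)
  qed
qed

text \<open>\<open>k1\<close>, \<open>k2\<close> are the ends of one diagonal and \<open>k3\<close>,
  \<open>k4\<close> those of the other. The pairing is chosen separately in each coordinate, which
  admits the degenerate case of coinciding diagonals.\<close>

definition is_rectangle :: "freq \<Rightarrow> freq \<Rightarrow> freq \<Rightarrow> freq \<Rightarrow> bool" where
  "is_rectangle k1 k2 k3 k4 \<longleftrightarrow>
     (fst k1 = fst k3 \<and> fst k2 = fst k4 \<or> fst k1 = fst k4 \<and> fst k2 = fst k3) \<and>
     (snd k1 = snd k3 \<and> snd k2 = snd k4 \<or> snd k1 = snd k4 \<and> snd k2 = snd k3)"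

text \<open>Sums and sums of squares agree in each coordinate, so
  \<open>sum_eq_sum_squares_eq_cases\<close> applies twice. Largeness is asked of the fourth
  frequency because it is the output mode of the cubic term.\<close>

lemma quasi_resonant_imp_is_rectangle:
  assumes "generic_irrational_pair \<omega>\<^sub>1 \<omega>\<^sub>2" and "\<Lambda> > 0" and "\<tau> > 0"
  obtains N :: nat where "\<And>k1 k2 k3 m l. quasi_resonant \<omega>\<^sub>1 \<omega>\<^sub>2 \<Lambda> \<tau> k1 k2 k3 (m, l) \<Longrightarrow>
      \<bar>m\<bar> > int N \<or> \<bar>l\<bar> > int N \<Longrightarrow> is_rectangle k1 k2 k3 (m, l)"
proof -
  obtain N0 where N0: "\<And>k1 k2 k3 k4. quasi_resonant \<omega>\<^sub>1 \<omega>\<^sub>2 \<Lambda> \<tau> k1 k2 k3 k4 \<Longrightarrow>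
      freq_sq k1 + freq_sq k2 + freq_sq k3 + freq_sq k4 > N0 \<Longrightarrow>
      (fst k1)\<^sup>2 + (fst k2)\<^sup>2 = (fst k3)\<^sup>2 + (fst k4)\<^sup>2 \<and>
      (snd k1)\<^sup>2 + (snd k2)\<^sup>2 = (snd k3)\<^sup>2 + (snd k4)\<^sup>2"
    using quasi_resonant_imp_squares_eq[OF assms] by blast
  define N where "N = nat \<lceil>N0\<rceil>"
  have sq: "N0 < (real_of_int a)\<^sup>2" if "\<bar>a\<bar> > int N" for a
  proof -
    have "N0 \<le> real N" by (simp add: N_def real_nat_ceiling_ge)
    also have "\<dots> < \<bar>real_of_int a\<bar>" using that by linarith
    also have "\<dots> \<le> (real_of_int a)\<^sup>2"
      using that self_le_power[of "\<bar>real_of_int a\<bar>" 2] by simp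
    finally show ?thesis .
  qed
  show ?thesis
  proof (rule that[of N])
    fix k1 k2 k3 m l
    assume qr: "quasi_resonant \<omega>\<^sub>1 \<omega>\<^sub>2 \<Lambda> \<tau> k1 k2 k3 (m, l)"
      and large: "\<bar>m\<bar> > int N \<or> \<bar>l\<bar> > int N"
    have nn: "freq_sq k \<ge> 0" for k by (simp add: freq_sq_def)
    have "freq_sq (m, l) > N0"
      using large
    proof
      assume "\<bar>m\<bar> > int N"
      then show ?thesis using sq[of m] by (simp add: freq_sq_def add_strict_increasing2 add.commute)
    next
      assume "\<bar>l\<bar> > int N"
      then show ?thesis using sq[of l] by (simp add: freq_sq_def add_strict_increasing2)
    qed
    then have "freq_sq k1 + freq_sq k2 + freq_sq k3 + freq_sq (m, l) > N0"
      using nn[of k1] nn[of k2] nn[of k3] by linarith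
    note squares = N0[OF qr this]
    have "k1 + k2 = k3 + (m, l)"
      using qr unfolding quasi_resonant_def by (simp add: algebra_simps)
    then have "fst k1 + fst k2 = fst k3 + fst (m, l)" "snd k1 + snd k2 = snd k3 + snd (m, l)"
      by (metis fst_add, metis snd_add)
    then show "is_rectangle k1 k2 k3 (m, l)"
      unfolding is_rectangle_def using squares sum_eq_sum_squares_eq_cases by blast
  qed
qed

subsection \<open>The trilinear sum over rectangles\<close>

text \<open>Allows trilinear sums to be estimated without a proof of summability: a divergent sum
  has the value 0, and the empty partial sum shows that \<open>B\<close> is nonnegative.\<close>

lemma norm_infsum_le_finite_sums:
  fixes f :: "'a \<Rightarrow> 'b::real_normed_vector"
  assumes "\<And>X. finite X \<Longrightarrow> X \<subseteq> A \<Longrightarrow> norm (sum f X) \<le> B"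
  shows "norm (infsum f A) \<le> B"
proof (cases "f summable_on A")
  case True
  then have "(sum f \<longlongrightarrow> infsum f A) (finite_subsets_at_top A)"
    using has_sum_infsum unfolding has_sum_def by blast
  then have "((\<lambda>X. norm (sum f X)) \<longlongrightarrow> norm (infsum f A)) (finite_subsets_at_top A)"
    by (rule tendsto_norm)
  then show ?thesis
    by (rule tendsto_upperbound)
       (use assms in \<open>auto intro!: eventually_finite_subsets_at_top_weakI\<close>)
next
  case False
  then show ?thesis using assms[of "{}"] by (simp add: infsum_not_exists)
qed

lemma sum_Un_le_nonneg:
  fixes f :: "'a \<Rightarrow> real"
  assumes "finite A" "finite B" "\<And>x. f x \<ge> 0"
  shows "sum f (A \<union> B) \<le> sum f A + sum f B"
  using sum.union_inter[OF assms(1,2), of f] sum_nonneg[of "A \<inter> B" f] assms(3) by simp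

lemma L2_set_prod:
  fixes a :: "'a \<Rightarrow> real" and b :: "'b \<Rightarrow> real"
  shows "L2_set (\<lambda>(p, q). a p * b q) (P \<times> Q) = L2_set a P * L2_set b Q"
proof -
  have "(\<Sum>(p, q)\<in>P \<times> Q. (a p * b q)\<^sup>2) = (\<Sum>p\<in>P. (a p)\<^sup>2) * (\<Sum>q\<in>Q. (b q)\<^sup>2)"
    by (simp add: sum_product power_mult_distrib flip: sum.cartesian_product)
  then show ?thesis
    unfolding L2_set_def by (simp add: real_sqrt_mult case_prod_unfold)
qed

text \<open>Interchanging the sums over the two coordinates shows that the l2 norms of the columns
  are again square-summable, with the total mass as bound.\<close>

lemma column_mass_bound:
  fixes c :: "freq \<Rightarrow> complex"
  assumes mass: "\<And>X. finite X \<Longrightarrow> L2_set (\<lambda>k. cmod (c k)) X \<le> K"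
  shows "(\<lambda>p. (cmod (c (p, l)))\<^sup>2) summable_on UNIV"
    and "finite L \<Longrightarrow> L2_set (\<lambda>l. sqrt (\<Sum>\<^sub>\<infinity>p. (cmod (c (p, l)))\<^sup>2)) L \<le> K"
proof -
  have K: "K \<ge> 0" using mass[of "{}"] by simp
  have bnd: "(\<Sum>k\<in>X. (cmod (c k))\<^sup>2) \<le> K\<^sup>2" if "finite X" for X
    using mass[OF that] unfolding L2_set_def by (rule sqrt_le_D)
  have summ: "(\<lambda>p. (cmod (c (p, l)))\<^sup>2) summable_on UNIV" for l
  proof (rule nonneg_bdd_above_summable_on)
    show "bdd_above (sum (\<lambda>p. (cmod (c (p, l)))\<^sup>2) ` {F. F \<subseteq> UNIV \<and> finite F})"
    proof (rule bdd_aboveI2)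
      fix F :: "int set" assume "F \<in> {F. F \<subseteq> UNIV \<and> finite F}"
      then show "(\<Sum>p\<in>F. (cmod (c (p, l)))\<^sup>2) \<le> K\<^sup>2"
        using bnd[of "(\<lambda>p. (p, l)) ` F"] by (simp add: sum.reindex inj_on_def)
    qed
  qed auto
  then show "(\<lambda>p. (cmod (c (p, l)))\<^sup>2) summable_on UNIV" .
  assume L: "finite L"
  have "((\<lambda>p. \<Sum>l\<in>L. (cmod (c (p, l)))\<^sup>2) has_sum (\<Sum>l\<in>L. \<Sum>\<^sub>\<infinity>p. (cmod (c (p, l)))\<^sup>2)) UNIV"
    using L
  proof (induction L)
    case (insert l L)
    then show ?case using summ by (simp add: has_sum_add)
  qed simp
  then have "(\<Sum>l\<in>L. \<Sum>\<^sub>\<infinity>p. (cmod (c (p, l)))\<^sup>2) = (\<Sum>\<^sub>\<infinity>p. \<Sum>l\<in>L. (cmod (c (p, l)))\<^sup>2)"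
    by (simp add: infsumI)
  also have "norm \<dots> \<le> K\<^sup>2"
  proof (rule norm_infsum_le_finite_sums)
    fix F :: "int set" assume "finite F"
    then show "norm (\<Sum>p\<in>F. \<Sum>l\<in>L. (cmod (c (p, l)))\<^sup>2) \<le> K\<^sup>2"
      using bnd[of "F \<times> L"] L by (simp add: sum.cartesian_product sum_nonneg)
  qed
  finally show "L2_set (\<lambda>l. sqrt (\<Sum>\<^sub>\<infinity>p. (cmod (c (p, l)))\<^sup>2)) L \<le> K"
    unfolding L2_set_def using K by (intro real_le_lsqrt) (auto simp: infsum_nonneg sum_nonneg)
qed

text \<open>A rectangle with fourth corner \<open>(m, l)\<close> is determined by its third corner up to four
  assignments of the first two, so the trilinear sum is controlled by two Cauchy-Schwarz
  inequalities in which one factor always lies in the row \<open>m\<close>.\<close>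

lemma rectangle_sum_row_bound:
  fixes c :: "freq \<Rightarrow> complex" and R :: "int \<Rightarrow> (freq \<times> freq \<times> freq) set"
  assumes R: "\<And>l k1 k2 k3. (k1, k2, k3) \<in> R l \<Longrightarrow> is_rectangle k1 k2 k3 (m, l)"
    and mass: "\<And>X. finite X \<Longrightarrow> L2_set (\<lambda>k. cmod (c k)) X \<le> K"
    and row: "\<And>L. finite L \<Longrightarrow> L2_set (\<lambda>l. cmod (c (m, l))) L \<le> r"
    and L: "finite L"
  shows "L2_set (\<lambda>l. cmod (\<Sum>\<^sub>\<infinity>(k1, k2, k3)\<in>R l. c k1 * c k2 * cnj (c k3))) L \<le> 4 * K\<^sup>2 * r"
proof -
  define b where "b l = sqrt (\<Sum>\<^sub>\<infinity>p. (cmod (c (p, l)))\<^sup>2)" for l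
  define f where "f = (\<lambda>(k1, k2, k3). c k1 * c k2 * cnj (c k3))"
  have K: "K \<ge> 0" using mass[of "{}"] by simp
  have r: "r \<ge> 0" using row[of "{}"] by simp
  have b0: "b l \<ge> 0" for l by (simp add: b_def infsum_nonneg)
  have col: "L2_set (\<lambda>p. cmod (c (p, l))) P \<le> b l" if "finite P" for P l
    unfolding b_def L2_set_def real_sqrt_le_iff
    using column_mass_bound(1)[OF mass] that by (intro finite_sum_le_infsum) auto
  have pointwise: "cmod (infsum f (R l)) \<le> 2 * K\<^sup>2 * cmod (c (m, l)) + 2 * K * r * b l" for l
  proof (rule norm_infsum_le_finite_sums)
    fix X assume X: "finite X" "X \<subseteq> R l"
    \<comment> \<open>The third corners are enclosed in a product set, over which sums of products
      of one-coordinate functions factor.\<close>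
    define P where "P = (\<lambda>(k1, k2, k3). fst k3) ` X"
    define Q where "Q = (\<lambda>(k1, k2, k3). snd k3) ` X"
    define Y where "Y = P \<times> Q"
    have fin: "finite P" "finite Q" "finite Y" using X by (auto simp: P_def Q_def Y_def)
    \<comment> \<open>In \<open>e1\<close> and \<open>e2\<close> one input is \<open>(m, l)\<close>
      itself and the other equals \<open>k\<close>. In \<open>e3\<close> and \<open>e4\<close> the
      inputs span the diagonal opposite to \<open>k\<close> and \<open>(m, l)\<close>, and
      \<open>(m, snd k)\<close> lies in the row \<open>m\<close>. Exchanging the two inputs yields
      the factors 2 in the pointwise bound.\<close>
    define e1 where "e1 k = (k, (m, l), k)" for k :: freq
    define e2 where "e2 k = ((m, l), k, k)" for k :: freq
    define e3 where "e3 k = ((fst k, l), (m, snd k), k)" for k :: freq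
    define e4 where "e4 k = ((m, snd k), (fst k, l), k)" for k :: freq
    have sub: "X \<subseteq> (e1 ` Y \<union> e2 ` Y) \<union> (e3 ` Y \<union> e4 ` Y)"
    proof
      fix x assume "x \<in> X"
      obtain k1 k2 k3 where x: "x = (k1, k2, k3)" by (cases x)
      have "k3 \<in> Y" using \<open>x \<in> X\<close> unfolding Y_def P_def Q_def x
        by (auto simp: mem_Times_iff intro!: image_eqI[where x = "(k1, k2, k3)"])
      moreover have "is_rectangle k1 k2 k3 (m, l)" using R X(2) \<open>x \<in> X\<close> unfolding x by blast
      then have "x = e1 k3 \<or> x = e2 k3 \<or> x = e3 k3 \<or> x = e4 k3"
        unfolding is_rectangle_def x e1_def e2_def e3_def e4_def by (auto simp: prod_eq_iff)
      ultimately show "x \<in> (e1 ` Y \<union> e2 ` Y) \<union> (e3 ` Y \<union> e4 ` Y)" by blast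
    qed
    define h where "h x = cmod (f x)" for x
    have im: "sum h (e ` Y) \<le> (\<Sum>k\<in>Y. h (e k))" for e
      using sum_image_le[of Y h e] fin by (simp add: h_def o_def)
    have Ysq: "(\<Sum>k\<in>Y. (cmod (c k))\<^sup>2) \<le> K\<^sup>2"
      using mass[OF fin(3)] unfolding L2_set_def by (rule sqrt_le_D)
    have d: "(\<Sum>k\<in>Y. cmod (c (m, l)) * (cmod (c k))\<^sup>2) \<le> K\<^sup>2 * cmod (c (m, l))"
      using mult_left_mono[OF Ysq, of "cmod (c (m, l))"]
      by (simp add: mult.commute flip: sum_distrib_left)
    \<comment> \<open>Cauchy-Schwarz for \<open>e3\<close> and \<open>e4\<close>: the product of the
      two inputs separates the variables, so its l2 norm is a column norm times a row norm, and the
      third factor contributes \<open>K\<close>.\<close>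
    have "(\<Sum>k\<in>Y. (cmod (c (fst k, l)) * cmod (c (m, snd k))) * cmod (c k))
        \<le> L2_set (\<lambda>k. cmod (c (fst k, l)) * cmod (c (m, snd k))) Y * L2_set (\<lambda>k. cmod (c k)) Y"
      using L2_set_mult_ineq[of "\<lambda>k. cmod (c (fst k, l)) * cmod (c (m, snd k))" "\<lambda>k. cmod (c k)" Y]
      by (simp add: abs_mult)
    also have "L2_set (\<lambda>k. cmod (c (fst k, l)) * cmod (c (m, snd k))) Y
        = L2_set (\<lambda>p. cmod (c (p, l))) P * L2_set (\<lambda>q. cmod (c (m, q))) Q"
      unfolding Y_def L2_set_prod[symmetric] by (simp add: case_prod_unfold)
    also have "\<dots> * L2_set (\<lambda>k. cmod (c k)) Y \<le> (b l * r) * K"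
      using col row mass fin b0 r by (intro mult_mono) auto
    finally have o: "(\<Sum>k\<in>Y. (cmod (c (fst k, l)) * cmod (c (m, snd k))) * cmod (c k)) \<le> K * r * b l"
      by (simp add: mult_ac)
    have "norm (sum f X) \<le> sum h X" unfolding h_def by (rule norm_sum)
    also have "\<dots> \<le> sum h ((e1 ` Y \<union> e2 ` Y) \<union> (e3 ` Y \<union> e4 ` Y))"
      using fin sub by (intro sum_mono2) (auto simp: h_def)
    also have "\<dots> \<le> (sum h (e1 ` Y) + sum h (e2 ` Y)) + (sum h (e3 ` Y) + sum h (e4 ` Y))"
      using fin sum_Un_le_nonneg[of "e1 ` Y" "e2 ` Y" h] sum_Un_le_nonneg[of "e3 ` Y" "e4 ` Y" h]
        sum_Un_le_nonneg[of "e1 ` Y \<union> e2 ` Y" "e3 ` Y \<union> e4 ` Y" h]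
      by (simp add: h_def)
    also have "\<dots> \<le> ((\<Sum>k\<in>Y. h (e1 k)) + (\<Sum>k\<in>Y. h (e2 k))) + ((\<Sum>k\<in>Y. h (e3 k)) + (\<Sum>k\<in>Y. h (e4 k)))"
      by (intro add_mono im)
    also have "\<dots> \<le> 2 * K\<^sup>2 * cmod (c (m, l)) + 2 * K * r * b l"
      using d o by (simp add: h_def f_def e1_def e2_def e3_def e4_def norm_mult power2_eq_square mult_ac)
    finally show "norm (sum f X) \<le> 2 * K\<^sup>2 * cmod (c (m, l)) + 2 * K * r * b l" .
  qed
  \<comment> \<open>Taking l2 norms in \<open>l\<close>, the first term gives
    \<open>2 * K\<^sup>2 * r\<close> by the row bound. The second gives the same because the column
    norms \<open>b\<close> have l2 norm at most \<open>K\<close>.\<close>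
  have "L2_set (\<lambda>l. cmod (infsum f (R l))) L
      \<le> L2_set (\<lambda>l. 2 * K\<^sup>2 * cmod (c (m, l)) + 2 * K * r * b l) L"
    using pointwise by (intro L2_set_mono) auto
  also have "\<dots> \<le> L2_set (\<lambda>l. 2 * K\<^sup>2 * cmod (c (m, l))) L + L2_set (\<lambda>l. 2 * K * r * b l) L"
    by (rule L2_set_triangle_ineq)
  also have "\<dots> = 2 * K\<^sup>2 * L2_set (\<lambda>l. cmod (c (m, l))) L + 2 * K * r * L2_set b L"
    using K r by (simp add: L2_set_right_distrib)
  also have "\<dots> \<le> 2 * K\<^sup>2 * r + 2 * K * r * K"
    using row[OF L] column_mass_bound(2)[OF mass L] K r unfolding b_def[symmetric, abs_def]
    by (intro add_mono mult_left_mono) auto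
  finally show ?thesis unfolding f_def by (simp add: power2_eq_square algebra_simps)
qed

text \<open>Swapping the coordinates of all frequencies preserves rectangles and exchanges rows with
  columns.\<close>

lemma rectangle_sum_col_bound:
  fixes c :: "freq \<Rightarrow> complex" and R :: "int \<Rightarrow> (freq \<times> freq \<times> freq) set"
  assumes R: "\<And>m k1 k2 k3. (k1, k2, k3) \<in> R m \<Longrightarrow> is_rectangle k1 k2 k3 (m, l)"
    and mass: "\<And>X. finite X \<Longrightarrow> L2_set (\<lambda>k. cmod (c k)) X \<le> K"
    and col: "\<And>L. finite L \<Longrightarrow> L2_set (\<lambda>m. cmod (c (m, l))) L \<le> r"
    and L: "finite L"
  shows "L2_set (\<lambda>m. cmod (\<Sum>\<^sub>\<infinity>(k1, k2, k3)\<in>R m. c k1 * c k2 * cnj (c k3))) L \<le> 4 * K\<^sup>2 * r"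
proof -
  define c' where "c' = c \<circ> prod.swap"
  define sw where "sw = map_prod (prod.swap :: freq \<Rightarrow> freq) (map_prod (prod.swap :: freq \<Rightarrow> freq) (prod.swap :: freq \<Rightarrow> freq))"
  have inj: "inj_on sw A" for A
    by (rule inj_on_subset[OF _ subset_UNIV]) (simp add: sw_def prod.inj_map)
  have "(\<Sum>\<^sub>\<infinity>(k1, k2, k3)\<in>sw ` R m. c' k1 * c' k2 * cnj (c' k3))
      = (\<Sum>\<^sub>\<infinity>(k1, k2, k3)\<in>R m. c k1 * c k2 * cnj (c k3))" for m
    by (subst infsum_reindex[OF inj]) (auto simp: sw_def c'_def o_def case_prod_unfold intro!: infsum_cong)
  moreover have "L2_set (\<lambda>m. cmod (\<Sum>\<^sub>\<infinity>(k1, k2, k3)\<in>sw ` R m. c' k1 * c' k2 * cnj (c' k3))) L \<le> 4 * K\<^sup>2 * r"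
  proof (rule rectangle_sum_row_bound[where m = l])
    fix m k1 k2 k3 assume "(k1, k2, k3) \<in> sw ` R m"
    then obtain j1 j2 j3 where j: "(j1, j2, j3) \<in> R m"
      and k: "k1 = prod.swap j1" "k2 = prod.swap j2" "k3 = prod.swap j3"
      by (auto simp: sw_def)
    show "is_rectangle k1 k2 k3 (l, m)"
      using R[OF j] unfolding k is_rectangle_def by simp
  next
    show "L2_set (\<lambda>k. cmod (c' k)) X \<le> K" if "finite X" for X
    proof -
      have "L2_set (\<lambda>k. cmod (c k)) (prod.swap ` X) = L2_set (\<lambda>k. cmod (c' k)) X"
        unfolding L2_set_def c'_def by (subst sum.reindex) (auto simp: inj_on_def)
      then show ?thesis using mass[of "prod.swap ` X"] that by simp
    qed
    show "L2_set (\<lambda>m. cmod (c' (l, m))) L \<le> r" if "finite L" for L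
      using col[OF that] by (simp add: c'_def)
  qed (fact L)
  ultimately show ?thesis by simp
qed

subsection \<open>Gronwall inequality for the Duhamel formula\<close>

lemma interval_lebesgue_integral_sum:
  fixes f :: "'i \<Rightarrow> real \<Rightarrow> complex"
  assumes "finite I" and "\<And>i. i \<in> I \<Longrightarrow> interval_lebesgue_integrable M a b (f i)"
  shows "interval_lebesgue_integrable M a b (\<lambda>u. \<Sum>i\<in>I. f i u)"
    and "interval_lebesgue_integral M a b (\<lambda>u. \<Sum>i\<in>I. f i u)
       = (\<Sum>i\<in>I. interval_lebesgue_integral M a b (f i))"
proof -
  have "interval_lebesgue_integrable M a b (\<lambda>u. \<Sum>i\<in>I. f i u) \<and>
      interval_lebesgue_integral M a b (\<lambda>u. \<Sum>i\<in>I. f i u)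
       = (\<Sum>i\<in>I. interval_lebesgue_integral M a b (f i))"
    using assms
  proof (induction I)
    case empty
    then show ?case
      by (simp add: interval_lebesgue_integrable_def set_integrable_def
          interval_lebesgue_integral_def set_lebesgue_integral_def)
  next
    case (insert i I)
    then show ?case by (simp add: interval_lebesgue_integral_add)
  qed
  then show "interval_lebesgue_integrable M a b (\<lambda>u. \<Sum>i\<in>I. f i u)"
    and "interval_lebesgue_integral M a b (\<lambda>u. \<Sum>i\<in>I. f i u)
       = (\<Sum>i\<in>I. interval_lebesgue_integral M a b (f i))" by auto
qed

text \<open>One step of a Picard iteration, valid for both signs of \<open>t\<close>: integrating
  the majorant raises the power by one and produces the factor that builds up the factorial.\<close>

lemma LBINT_powr_le:
  fixes f :: "real \<Rightarrow> complex" and t a T :: real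
  assumes bound: "\<And>u. \<bar>u\<bar> \<le> T \<Longrightarrow> cmod (f u) \<le> a * \<bar>u\<bar> ^ n"
    and int: "interval_lebesgue_integrable lborel (ereal 0) (ereal t) f"
    and t: "\<bar>t\<bar> \<le> T"
  shows "cmod (LBINT u=ereal 0..ereal t. f u) \<le> a * \<bar>t\<bar> ^ Suc n / Suc n"
proof -
  \<comment> \<open>The interval is taken without orientation; for negative \<open>t\<close> the
    oriented integral differs by a sign, which the norm ignores.\<close>
  have pos: "cmod (LBINT u:I. f u) \<le> a * \<bar>t\<bar> ^ Suc n / Suc n"
    if I: "I = {min 0 t<..<max 0 t}" and int: "set_integrable lborel I f" for I
  proof -
    define g where "g u = a * \<bar>u\<bar> ^ n" for u :: real
    \<comment> \<open>Keeping one factor \<open>u\<close> outside the modulus gives an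
      antiderivative of \<open>g\<close> on both half-lines.\<close>
    define G where "G u = a * u * \<bar>u\<bar> ^ n / Suc n" for u :: real
    have cont: "continuous_on X g" for X unfolding g_def by (intro continuous_intros)
    have gI: "set_integrable lborel I g" unfolding I
      by (rule set_integrable_subset[OF borel_integrable_atLeastAtMost'[OF cont[of "{min 0 t..max 0 t}"]]]) auto
    have deriv: "(G has_vector_derivative g x) (at x within {min 0 t..max 0 t})"
      if "min 0 t \<le> x" "x \<le> max 0 t" for x
    proof (cases "t \<ge> 0")
      case True
      have "((\<lambda>u. a * u ^ Suc n / Suc n) has_vector_derivative g x) (at x within {min 0 t..max 0 t})"
        unfolding has_real_derivative_iff_has_vector_derivative[symmetric]
        by (rule DERIV_cong[OF DERIV_cdivide[OF DERIV_cmult[OF DERIV_pow]]])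
           (use True that in \<open>simp add: g_def\<close>)
      then show ?thesis
        by (rule has_vector_derivative_transform[rotated 2]) (use True that in \<open>auto simp: G_def\<close>)
    next
      case False
      have deriv: "((\<lambda>u. (a * (-1) ^ n) * u ^ Suc n / Suc n) has_vector_derivative g x) (at x within {min 0 t..max 0 t})"
        unfolding has_real_derivative_iff_has_vector_derivative[symmetric]
        by (rule DERIV_cong[OF DERIV_cdivide[OF DERIV_cmult[OF DERIV_pow]]])
           (use False that in \<open>simp add: g_def power_minus[of x]\<close>)
      have eq: "(a * (-1) ^ n) * u ^ Suc n / Suc n = G u" if "u \<le> 0" for u
        using that power_minus[of u n] by (simp add: G_def)
      show ?thesis
        by (rule has_vector_derivative_transform[OF _ _ deriv]) (use False that eq in auto)
    qed
    have "norm (LBINT u:I. f u) \<le> (LBINT u:I. g u)"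
      unfolding set_lebesgue_integral_def
    proof (rule Bochner_Integration.integral_norm_bound_integral)
      show "integrable lborel (\<lambda>u. indicat_real I u *\<^sub>R f u)"
           "integrable lborel (\<lambda>u. indicat_real I u *\<^sub>R g u)"
        using int gI by (simp_all add: set_integrable_def)
    next
      fix u
      show "norm (indicat_real I u *\<^sub>R f u) \<le> indicat_real I u *\<^sub>R g u"
        using bound[of u] t by (auto simp: I g_def indicator_def min_def max_def split: if_splits)
    qed
    also have "(LBINT u:I. g u) = (LBINT u=ereal (min 0 t)..ereal (max 0 t). g u)"
      unfolding I by (cases "t \<ge> 0") (simp_all add: interval_lebesgue_integral_def min_def max_def)
    also have "\<dots> = G (max 0 t) - G (min 0 t)"
      by (rule interval_integral_FTC_finite[OF cont]) (use deriv in auto)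
    also have "\<dots> = a * \<bar>t\<bar> ^ Suc n / Suc n"
      by (auto simp: G_def min_def max_def)
    finally show ?thesis .
  qed
  show ?thesis
  proof (cases "0 \<le> t")
    case True
    then show ?thesis using int pos[OF refl]
      by (simp add: interval_lebesgue_integral_def interval_lebesgue_integrable_def)
  next
    case False
    then show ?thesis using int pos[OF refl]
      by (simp add: interval_lebesgue_integral_def interval_lebesgue_integrable_def)
  qed
qed

lemma L2_set_cmod_sq: "(L2_set (\<lambda>l. cmod (f l)) L)\<^sup>2 = (\<Sum>l\<in>L. (cmod (f l))\<^sup>2)"
  unfolding L2_set_def by (simp add: sum_nonneg)

text \<open>Pairing the vector of integrals with itself gives Minkowski's inequality for
  integrals without square-integrability in time. A coefficient whose integrand is not integrable
  is an integral of value 0 and drops out.\<close>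

lemma duhamel_gronwall_step:
  fixes g G :: "real \<Rightarrow> 'a \<Rightarrow> complex" and \<mu> :: "'a \<Rightarrow> real" and \<epsilon> T a t :: real
  assumes duhamel: "\<And>l. l \<in> L \<Longrightarrow> g t l = - (\<i> * complex_of_real \<epsilon> *
            (LBINT u=ereal 0..ereal t. cis (\<mu> l * (t - u)) * G u l))"
    and \<epsilon>: "\<bar>\<epsilon>\<bar> = 1" and L: "finite L"
    and bound: "\<And>u L. \<bar>u\<bar> \<le> T \<Longrightarrow> finite L \<Longrightarrow> L2_set (\<lambda>l. cmod (G u l)) L \<le> a * \<bar>u\<bar> ^ n"
    and t: "\<bar>t\<bar> \<le> T" and a: "a \<ge> 0"
  shows "L2_set (\<lambda>l. cmod (g t l)) L \<le> a * \<bar>t\<bar> ^ Suc n / Suc n"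
proof -
  define h where "h l u = cis (\<mu> l * (t - u)) * G u l" for l u
  define L' where "L' = {l \<in> L. interval_lebesgue_integrable lborel (ereal 0) (ereal t) (h l)}"
  have L': "finite L'" "L' \<subseteq> L" using L by (auto simp: L'_def)
  have zero: "g t l = 0" if "l \<in> L - L'" for l
  proof -
    have "\<not> interval_lebesgue_integrable lborel (ereal 0) (ereal t) (h l)"
      using that by (auto simp: L'_def)
    then have "(LBINT u=ereal 0..ereal t. h l u) = 0"
      by (auto simp: interval_lebesgue_integrable_def interval_lebesgue_integral_def
          set_integrable_def set_lebesgue_integral_def not_integrable_integral_eq split: if_splits)
    then show ?thesis using duhamel that unfolding h_def by simp
  qed
  define N where "N = L2_set (\<lambda>l. cmod (g t l)) L'"
  have N: "L2_set (\<lambda>l. cmod (g t l)) L = N"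
    unfolding N_def L2_set_def using zero L' L by (intro arg_cong[where f=sqrt] sum.mono_neutral_right) auto
  \<comment> \<open>The vector \<open>g t\<close> is fixed while \<open>u\<close> varies. The
    integral of \<open>H\<close> has modulus \<open>N\<^sup>2\<close>, and Cauchy-Schwarz bounds
    \<open>H\<close> by \<open>N\<close> times the assumed majorant.\<close>
  define H where "H u = (\<Sum>l\<in>L'. cnj (g t l) * h l u)" for u
  have int: "interval_lebesgue_integrable lborel (ereal 0) (ereal t) H"
    unfolding H_def using L'(1)
    by (intro interval_lebesgue_integral_sum) (auto simp: L'_def)
  have "cmod (H u) \<le> (N * a) * \<bar>u\<bar> ^ n" if "\<bar>u\<bar> \<le> T" for u
  proof -
    have "cmod (H u) \<le> (\<Sum>l\<in>L'. \<bar>cmod (g t l)\<bar> * \<bar>cmod (G u l)\<bar>)"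
      unfolding H_def h_def by (rule order_trans[OF norm_sum]) (simp add: norm_mult)
    also have "\<dots> \<le> N * L2_set (\<lambda>l. cmod (G u l)) L'"
      unfolding N_def by (rule L2_set_mult_ineq)
    also have "\<dots> \<le> N * (a * \<bar>u\<bar> ^ n)"
      using bound[OF that L'(1)] by (intro mult_left_mono) (auto simp: N_def)
    finally show ?thesis by (simp add: mult_ac)
  qed
  then have HI: "cmod (LBINT u=ereal 0..ereal t. H u) \<le> (N * a) * \<bar>t\<bar> ^ Suc n / Suc n"
    using int t by (rule LBINT_powr_le)
  have "(LBINT u=ereal 0..ereal t. H u) = (\<Sum>l\<in>L'. cnj (g t l) * (LBINT u=ereal 0..ereal t. h l u))"
    unfolding H_def using L'(1)
    by (subst interval_lebesgue_integral_sum) (auto simp: L'_def)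
  then have "- (\<i> * complex_of_real \<epsilon>) * (LBINT u=ereal 0..ereal t. H u) = (\<Sum>l\<in>L'. cnj (g t l) * g t l)"
    using L'(2) duhamel unfolding h_def by (auto simp: sum_distrib_left mult_ac intro!: sum.cong)
  also have "\<dots> = complex_of_real (N\<^sup>2)"
    unfolding N_def L2_set_cmod_sq of_real_sum
    by (intro sum.cong) (auto simp: complex_norm_square simp flip: of_real_power)
  finally have "cmod (complex_of_real (N\<^sup>2)) = cmod (LBINT u=ereal 0..ereal t. H u)"
    using \<epsilon> by (metis mult_1 norm_minus_cancel norm_mult norm_ii norm_of_real)
  then have "N * N \<le> N * (a * \<bar>t\<bar> ^ Suc n / Suc n)"
    using HI by (simp add: power2_eq_square mult_ac norm_mult)
  moreover have "N \<ge> 0" by (simp add: N_def)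
  moreover have "a * \<bar>t\<bar> ^ Suc n / Suc n \<ge> 0" using a by simp
  \<comment> \<open>One factor \<open>N\<close> is cancelled if it is positive; for
    \<open>N = 0\<close> the claim is the nonnegativity of the right-hand side.\<close>
  ultimately show ?thesis unfolding N by (metis mult_le_cancel_left_pos order_le_less)
qed

text \<open>Gronwall by iteration: the a priori bound \<open>S\<close> is improved to
  \<open>S * (D * \<bar>t\<bar>) ^ n / fact n\<close> for every \<open>n\<close>, and this tends to
  0. No continuity of the l2 norm in time enters.\<close>

lemma duhamel_gronwall:
  fixes g G :: "real \<Rightarrow> 'a \<Rightarrow> complex" and \<mu> :: "'a \<Rightarrow> real" and \<epsilon> T S D :: real
  assumes duhamel: "\<And>t l. g t l = - (\<i> * complex_of_real \<epsilon> *
            (LBINT u=ereal 0..ereal t. cis (\<mu> l * (t - u)) * G u l))"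
    and \<epsilon>: "\<bar>\<epsilon>\<bar> = 1"
    and g_bound: "\<And>u L. \<bar>u\<bar> \<le> T \<Longrightarrow> finite L \<Longrightarrow> L2_set (\<lambda>l. cmod (g u l)) L \<le> S"
    and G_bound: "\<And>u r L. \<bar>u\<bar> \<le> T \<Longrightarrow> (\<And>L. finite L \<Longrightarrow> L2_set (\<lambda>l. cmod (g u l)) L \<le> r) \<Longrightarrow>
            finite L \<Longrightarrow> L2_set (\<lambda>l. cmod (G u l)) L \<le> D * r"
    and D: "D \<ge> 0" and t: "\<bar>t\<bar> \<le> T"
  shows "g t l = 0"
proof -
  have S: "S \<ge> 0" using g_bound[of 0 "{}"] t by simp
  have iter: "L2_set (\<lambda>l. cmod (g u l)) L \<le> S * D ^ n / fact n * \<bar>u\<bar> ^ n"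
    if "\<bar>u\<bar> \<le> T" "finite L" for u L n
    using that
  proof (induction n arbitrary: u L)
    case 0
    then show ?case using g_bound by simp
  next
    case (Suc n)
    \<comment> \<open>The closed estimate is used at each time \<open>v\<close> separately, with the
      induction hypothesis at \<open>v\<close> as the value of \<open>r\<close>.\<close>
    have "L2_set (\<lambda>l. cmod (G v l)) L \<le> (D * (S * D ^ n / fact n)) * \<bar>v\<bar> ^ n"
      if "\<bar>v\<bar> \<le> T" "finite L" for v L
      using G_bound[OF that(1) Suc.IH[OF that(1)] that(2)] by (simp add: mult_ac)
    then have "L2_set (\<lambda>l. cmod (g u l)) L \<le> (D * (S * D ^ n / fact n)) * \<bar>u\<bar> ^ Suc n / Suc n"
      using S D Suc.prems
      by (intro duhamel_gronwall_step[where G = G and g = g and t = u and T = T and L = L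
            and \<mu> = \<mu> and \<epsilon> = \<epsilon>, OF duhamel \<epsilon>]) auto
    also have "\<dots> = S * D ^ Suc n / fact (Suc n) * \<bar>u\<bar> ^ Suc n"
      by (simp add: field_simps)
    finally show ?case .
  qed
  have "(\<lambda>n. S * ((D * \<bar>t\<bar>) ^ n / fact n)) \<longlonglongrightarrow> S * 0"
    using summable_LIMSEQ_zero[OF summable_exp[of "D * \<bar>t\<bar>"]]
    by (intro tendsto_mult_left) (simp add: field_simps)
  moreover have "cmod (g t l) \<le> S * ((D * \<bar>t\<bar>) ^ n / fact n)" for n
    using iter[OF t, of "{l}" n] by (simp add: power_mult_distrib)
  ultimately have "cmod (g t l) \<le> 0" by (intro LIMSEQ_le_const[of _ _ "cmod (g t l)"]) auto
  then show ?thesis by simp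
qed

subsection \<open>Fourier coefficients on the torus\<close>

definition character :: "real \<Rightarrow> real \<Rightarrow> freq \<Rightarrow> real \<times> real \<Rightarrow> complex" where
  "character \<omega>\<^sub>1 \<omega>\<^sub>2 k x =
     cis (2 * pi * (real_of_int (fst k) * fst x / \<omega>\<^sub>1 + real_of_int (snd k) * snd x / \<omega>\<^sub>2))"

lemma norm_character [simp]: "cmod (character \<omega>\<^sub>1 \<omega>\<^sub>2 k x) = 1"
  by (simp add: character_def)

lemma character_mult_cnj:
  "character \<omega>\<^sub>1 \<omega>\<^sub>2 k x * cnj (character \<omega>\<^sub>1 \<omega>\<^sub>2 j x) = character \<omega>\<^sub>1 \<omega>\<^sub>2 (k - j) x"
  by (simp add: character_def cis_mult cis_cnj algebra_simps diff_divide_distrib)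

lemma rectangle_borel: "{0..<\<omega>\<^sub>1} \<times> {0..<\<omega>\<^sub>2} \<in> sets (borel :: (real \<times> real) measure)"
  by (simp add: borel_prod[symmetric])

lemma borel_measurable_torus:
  "f \<in> borel_measurable borel \<Longrightarrow> f \<in> borel_measurable (torus \<omega>\<^sub>1 \<omega>\<^sub>2)"
  unfolding torus_def by (rule measurable_restrict_space1) simp

lemma character_measurable [measurable, simp]:
  "character \<omega>\<^sub>1 \<omega>\<^sub>2 k \<in> borel_measurable (torus \<omega>\<^sub>1 \<omega>\<^sub>2)"
  unfolding character_def[abs_def] divide_inverse
  by (intro borel_measurable_torus borel_measurable_continuous_onI continuous_intros)

lemma cnj_character_measurable [measurable, simp]:
  "(\<lambda>x. cnj (character \<omega>\<^sub>1 \<omega>\<^sub>2 k x)) \<in> borel_measurable (torus \<omega>\<^sub>1 \<omega>\<^sub>2)"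
proof -
  have "(\<lambda>x. cnj (character \<omega>\<^sub>1 \<omega>\<^sub>2 k x)) = character \<omega>\<^sub>1 \<omega>\<^sub>2 (- k)"
    by (simp add: fun_eq_iff character_def cis_cnj algebra_simps)
  then show ?thesis by simp
qed

lemma finite_measure_torus: "finite_measure (torus \<omega>\<^sub>1 \<omega>\<^sub>2)"
proof (rule finite_measureI)
  have "bounded ({0..<\<omega>\<^sub>1} \<times> {0..<\<omega>\<^sub>2})"
    by (intro bounded_Times bounded_subset[OF bounded_closed_interval[of 0 \<omega>\<^sub>1]]
        bounded_subset[OF bounded_closed_interval[of 0 \<omega>\<^sub>2]]) auto
  from emeasure_bounded_finite[OF this]
  show "emeasure (torus \<omega>\<^sub>1 \<omega>\<^sub>2) (space (torus \<omega>\<^sub>1 \<omega>\<^sub>2)) \<noteq> \<infinity>"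
    unfolding torus_def
    by (subst emeasure_restrict_space) (auto simp: space_restrict_space rectangle_borel)
qed

lemma character_integrable: "integrable (torus \<omega>\<^sub>1 \<omega>\<^sub>2) (character \<omega>\<^sub>1 \<omega>\<^sub>2 k)"
  by (rule finite_measure.integrable_const_bound[OF finite_measure_torus, where B = 1]) auto

lemma integral_cis_period:
  assumes "\<omega> > 0"
  shows "(LBINT x:{0..<\<omega>}. cis (2 * pi * (real_of_int n * x / \<omega>))) = (if n = 0 then complex_of_real \<omega> else 0)"
proof (cases "n = 0")
  case True
  have "(LBINT x:{0..<\<omega>}. (1::complex)) = complex_of_real \<omega>"
    using assms by (simp add: set_lebesgue_integral_def scaleR_conv_of_real)
  then show ?thesis using True by simp
next
  case False
  define a where "a = 2 * pi * real_of_int n / \<omega>"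
  have a: "a \<noteq> 0" using False assms by (simp add: a_def)
  define F where "F x = cis (a * x) / (\<i> * complex_of_real a)" for x
  have deriv: "(F has_vector_derivative cis (a * x)) (at x within S)" for x S
    unfolding F_def has_vector_derivative_def
    using a by (auto intro!: derivative_eq_intros simp: scaleR_conv_of_real field_simps)
  have "(LBINT x:{0..<\<omega>}. cis (a * x)) = (LBINT x=ereal 0..ereal \<omega>. cis (a * x))"
    using assms by (subst interval_integral_Ico) auto
  also have "\<dots> = F \<omega> - F 0"
    by (rule interval_integral_FTC_finite) (auto intro!: continuous_intros deriv)
  also have "\<dots> = 0"
    using assms cis_multiple_2pi[of "real_of_int n"] by (simp add: F_def a_def)
  finally show ?thesis using False by (simp add: a_def mult_ac)
qed

text \<open>With \<open>character_mult_cnj\<close> this is the orthogonality of the characters. The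
  integrand is a product over the coordinates, so Fubini reduces it to one period integral
  each.\<close>

lemma integral_character:
  assumes "\<omega>\<^sub>1 > 0" "\<omega>\<^sub>2 > 0"
  shows "(LINT x|torus \<omega>\<^sub>1 \<omega>\<^sub>2. character \<omega>\<^sub>1 \<omega>\<^sub>2 k x) = (if k = 0 then complex_of_real (\<omega>\<^sub>1 * \<omega>\<^sub>2) else 0)"
proof -
  define A where "A = {0..<\<omega>\<^sub>1}"
  define B where "B = {0..<\<omega>\<^sub>2}"
  define u where "u x = cis (2 * pi * (real_of_int (fst k) * x / \<omega>\<^sub>1))" for x
  define v where "v x = cis (2 * pi * (real_of_int (snd k) * x / \<omega>\<^sub>2))" for x
  define h where "h x = indicat_real (A \<times> B) x *\<^sub>R character \<omega>\<^sub>1 \<omega>\<^sub>2 k x" for x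
  have meas: "A \<times> B \<inter> space lborel \<in> sets lborel" by (simp add: A_def B_def rectangle_borel)
  have h: "h (x, y) = (indicat_real A x *\<^sub>R u x) * (indicat_real B y *\<^sub>R v y)" for x y
    unfolding h_def character_def u_def v_def
    by (simp add: cis_mult distrib_left indicator_times)
  have "integrable lborel h"
    using character_integrable[of \<omega>\<^sub>1 \<omega>\<^sub>2 k] integrable_restrict_space[OF meas]
    unfolding torus_def A_def B_def h_def by blast
  then have int: "integrable (lborel \<Otimes>\<^sub>M lborel) h" by (simp add: lborel_prod)
  have "(LINT x|torus \<omega>\<^sub>1 \<omega>\<^sub>2. character \<omega>\<^sub>1 \<omega>\<^sub>2 k x) = (LINT x|lborel. h x)"
    using integral_restrict_space[OF meas, of "character \<omega>\<^sub>1 \<omega>\<^sub>2 k"]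
    unfolding torus_def A_def B_def h_def by simp
  also have "\<dots> = (LINT x|(lborel \<Otimes>\<^sub>M lborel). h x)" by (simp add: lborel_prod)
  also have "\<dots> = (LINT x|lborel. LINT y|lborel. h (x, y))"
    by (rule lborel_pair.integral_fst'[OF int, symmetric])
  also have "\<dots> = (LBINT x:A. u x) * (LBINT y:B. v y)"
    unfolding h set_lebesgue_integral_def
    by (simp only: integral_mult_right_zero integral_mult_left_zero)
  also have "\<dots> = (if k = 0 then complex_of_real (\<omega>\<^sub>1 * \<omega>\<^sub>2) else 0)"
    unfolding A_def B_def u_def v_def integral_cis_period[OF assms(1)] integral_cis_period[OF assms(2)]
    by (cases k) (auto simp: zero_prod_def)
  finally show ?thesis .
qed

lemma fourier_coeff_character:
  "fourier_coeff \<omega>\<^sub>1 \<omega>\<^sub>2 f k = (LINT x|torus \<omega>\<^sub>1 \<omega>\<^sub>2. f x * cnj (character \<omega>\<^sub>1 \<omega>\<^sub>2 k x)) / complex_of_real (\<omega>\<^sub>1 * \<omega>\<^sub>2)"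
  unfolding fourier_coeff_def character_def cis_cnj by simp

text \<open>The torus has finite measure, so \<open>1 + (cmod (f x))\<^sup>2\<close> is an
  integrable majorant of \<open>cmod (f x)\<close>.\<close>

lemma L2_torus_integrable_mult_bounded:
  assumes f: "f \<in> L2_torus \<omega>\<^sub>1 \<omega>\<^sub>2" and h: "h \<in> borel_measurable (torus \<omega>\<^sub>1 \<omega>\<^sub>2)" "\<And>x. cmod (h x) \<le> B"
  shows "integrable (torus \<omega>\<^sub>1 \<omega>\<^sub>2) (\<lambda>x. f x * h x)"
proof -
  interpret finite_measure "torus \<omega>\<^sub>1 \<omega>\<^sub>2" by (rule finite_measure_torus)
  have [measurable]: "f \<in> borel_measurable (torus \<omega>\<^sub>1 \<omega>\<^sub>2)" "h \<in> borel_measurable (torus \<omega>\<^sub>1 \<omega>\<^sub>2)"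
    and int: "integrable (torus \<omega>\<^sub>1 \<omega>\<^sub>2) (\<lambda>x. (cmod (f x))\<^sup>2)"
    using f h by (auto simp: L2_torus_def)
  show ?thesis
  proof (rule Bochner_Integration.integrable_bound)
    show "integrable (torus \<omega>\<^sub>1 \<omega>\<^sub>2) (\<lambda>x. (1 + (cmod (f x))\<^sup>2) * B)" using int by simp
    show "AE x in torus \<omega>\<^sub>1 \<omega>\<^sub>2. norm (f x * h x) \<le> norm ((1 + (cmod (f x))\<^sup>2) * B)"
    proof (rule AE_I2)
      fix x
      have "0 \<le> (cmod (f x) - 1)\<^sup>2" by simp
      then have "2 * cmod (f x) \<le> 1 + (cmod (f x))\<^sup>2"
        by (simp add: power2_eq_square algebra_simps)
      then have "cmod (f x) \<le> 1 + (cmod (f x))\<^sup>2"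
        using norm_ge_zero[of "f x"] by linarith
      then have "cmod (f x) * cmod (h x) \<le> (1 + (cmod (f x))\<^sup>2) * B"
        using h(2)[of x] by (intro mult_mono) auto
      then show "norm (f x * h x) \<le> norm ((1 + (cmod (f x))\<^sup>2) * B)"
        by (simp add: norm_mult)
    qed
  qed measurable
qed

lemma L2_torus_diff:
  assumes f: "f \<in> L2_torus \<omega>\<^sub>1 \<omega>\<^sub>2" and g: "g \<in> L2_torus \<omega>\<^sub>1 \<omega>\<^sub>2"
  shows "(\<lambda>x. f x - g x) \<in> L2_torus \<omega>\<^sub>1 \<omega>\<^sub>2"
proof -
  have [measurable]: "f \<in> borel_measurable (torus \<omega>\<^sub>1 \<omega>\<^sub>2)" "g \<in> borel_measurable (torus \<omega>\<^sub>1 \<omega>\<^sub>2)"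
    and int: "integrable (torus \<omega>\<^sub>1 \<omega>\<^sub>2) (\<lambda>x. (cmod (f x))\<^sup>2)" "integrable (torus \<omega>\<^sub>1 \<omega>\<^sub>2) (\<lambda>x. (cmod (g x))\<^sup>2)"
    using f g by (auto simp: L2_torus_def)
  have "integrable (torus \<omega>\<^sub>1 \<omega>\<^sub>2) (\<lambda>x. (cmod (f x - g x))\<^sup>2)"
  proof (rule Bochner_Integration.integrable_bound)
    show "integrable (torus \<omega>\<^sub>1 \<omega>\<^sub>2) (\<lambda>x. 2 * (cmod (f x))\<^sup>2 + 2 * (cmod (g x))\<^sup>2)" using int by simp
    show "AE x in torus \<omega>\<^sub>1 \<omega>\<^sub>2. norm ((cmod (f x - g x))\<^sup>2) \<le> norm (2 * (cmod (f x))\<^sup>2 + 2 * (cmod (g x))\<^sup>2)"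
    proof (rule AE_I2)
      fix x
      have "(cmod (f x - g x))\<^sup>2 \<le> (cmod (f x) + cmod (g x))\<^sup>2"
        by (intro power_mono norm_triangle_ineq4) simp
      also have "\<dots> \<le> 2 * (cmod (f x))\<^sup>2 + 2 * (cmod (g x))\<^sup>2"
        using sum_squares_bound[of "cmod (f x)" "cmod (g x)"] by (simp add: power2_sum)
      finally show "norm ((cmod (f x - g x))\<^sup>2) \<le> norm (2 * (cmod (f x))\<^sup>2 + 2 * (cmod (g x))\<^sup>2)"
        by simp
    qed
  qed measurable
  then show ?thesis unfolding L2_torus_def by simp
qed

lemma fourier_coeff_diff:
  assumes "f \<in> L2_torus \<omega>\<^sub>1 \<omega>\<^sub>2" "g \<in> L2_torus \<omega>\<^sub>1 \<omega>\<^sub>2"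
  shows "fourier_coeff \<omega>\<^sub>1 \<omega>\<^sub>2 (\<lambda>x. f x - g x) k = fourier_coeff \<omega>\<^sub>1 \<omega>\<^sub>2 f k - fourier_coeff \<omega>\<^sub>1 \<omega>\<^sub>2 g k"
  using assms unfolding fourier_coeff_character left_diff_distrib
  by (subst Bochner_Integration.integral_diff)
     (auto intro!: L2_torus_integrable_mult_bounded[where B = 1] simp: diff_divide_distrib)

text \<open>The square distance of \<open>f\<close> to its partial Fourier sum \<open>p\<close> is
  nonnegative. By orthogonality both mixed terms and the square of \<open>p\<close> integrate to
  \<open>V * S\<close>, which leaves the mass of \<open>f\<close> minus
  \<open>V * S\<close>.\<close>

lemma bessel_inequality:
  assumes f: "f \<in> L2_torus \<omega>\<^sub>1 \<omega>\<^sub>2" and \<omega>: "\<omega>\<^sub>1 > 0" "\<omega>\<^sub>2 > 0" and L: "finite L"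
  shows "L2_set (\<lambda>k. cmod (fourier_coeff \<omega>\<^sub>1 \<omega>\<^sub>2 f k)) L
    \<le> sqrt (LINT x|torus \<omega>\<^sub>1 \<omega>\<^sub>2. (cmod (f x))\<^sup>2) / sqrt (\<omega>\<^sub>1 * \<omega>\<^sub>2)"
proof -
  define T where "T = torus \<omega>\<^sub>1 \<omega>\<^sub>2"
  define V where "V = \<omega>\<^sub>1 * \<omega>\<^sub>2"
  define c where "c = fourier_coeff \<omega>\<^sub>1 \<omega>\<^sub>2 f"
  define e where "e = character \<omega>\<^sub>1 \<omega>\<^sub>2"
  define p where "p x = (\<Sum>k\<in>L. c k * e k x)" for x
  define S where "S = (\<Sum>k\<in>L. (cmod (c k))\<^sup>2)"
  have V: "V > 0" using \<omega> by (simp add: V_def)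
  have [measurable]: "f \<in> borel_measurable T" "\<And>k. e k \<in> borel_measurable T"
    and int_sq: "integrable T (\<lambda>x. (cmod (f x))\<^sup>2)"
    using f by (auto simp: L2_torus_def T_def e_def)
  have [measurable]: "p \<in> borel_measurable T" unfolding p_def by measurable
  have p_le: "cmod (p x) \<le> (\<Sum>k\<in>L. cmod (c k))" for x
    unfolding p_def by (rule order_trans[OF norm_sum]) (simp add: norm_mult e_def)
  have fe: "integrable T (\<lambda>x. f x * cnj (e k x))" for k
    unfolding T_def e_def using f by (rule L2_torus_integrable_mult_bounded[where B = 1]) auto
  have fe': "(LINT x|T. f x * cnj (e k x)) = V * c k" for k
    using \<omega> unfolding c_def fourier_coeff_character T_def e_def V_def by simp
  have ee: "integrable T (\<lambda>x. e k x * cnj (e j x))"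
    and ee': "(LINT x|T. e k x * cnj (e j x)) = (if j = k then V else 0)" for k j
    unfolding e_def character_mult_cnj T_def V_def
    using character_integrable integral_character[OF \<omega>] by auto
  have cc: "(\<Sum>k\<in>L. cnj (c k) * (V * c k)) = complex_of_real (V * S)"
    by (simp add: S_def sum_distrib_left of_real_sum complex_norm_square mult_ac del: of_real_power)
  have fp: "integrable T (\<lambda>x. f x * cnj (p x))" "(LINT x|T. f x * cnj (p x)) = complex_of_real (V * S)"
  proof -
    have eq: "f x * cnj (p x) = (\<Sum>k\<in>L. cnj (c k) * (f x * cnj (e k x)))" for x
      unfolding p_def by (simp add: sum_distrib_left mult_ac)
    show "integrable T (\<lambda>x. f x * cnj (p x))" unfolding eq using fe by simp
    show "(LINT x|T. f x * cnj (p x)) = complex_of_real (V * S)"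
      unfolding eq cc[symmetric] using fe fe' by simp
  qed
  have pp: "integrable T (\<lambda>x. p x * cnj (p x))" "(LINT x|T. p x * cnj (p x)) = complex_of_real (V * S)"
  proof -
    have eq: "p x * cnj (p x) = (\<Sum>k\<in>L. \<Sum>j\<in>L. (c k * cnj (c j)) * (e k x * cnj (e j x)))" for x
      unfolding p_def by (simp add: sum_product mult_ac)
    show "integrable T (\<lambda>x. p x * cnj (p x))" unfolding eq using ee by simp
    have "(LINT x|T. p x * cnj (p x)) = (\<Sum>k\<in>L. \<Sum>j\<in>L. (c k * cnj (c j)) * (if j = k then V else 0))"
      unfolding eq using ee ee' by simp
    also have "\<dots> = (\<Sum>k\<in>L. cnj (c k) * (V * c k))"
      using L by (intro sum.cong) (auto simp: if_distrib mult_ac cong: if_cong)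
    finally show "(LINT x|T. p x * cnj (p x)) = complex_of_real (V * S)" using cc by simp
  qed
  have ff: "integrable T (\<lambda>x. complex_of_real ((cmod (f x))\<^sup>2))" using int_sq by (rule integrable_of_real)
  have pf: "integrable T (\<lambda>x. cnj (f x * cnj (p x)))" using fp(1) by (rule integrable_cnj)
  have pf': "(LINT x|T. cnj (f x * cnj (p x))) = complex_of_real (V * S)"
    using integral_bounded_linear[OF bounded_linear_cnj fp(1)] fp(2)
    by (simp only: complex_cnj_complex_of_real)
  \<comment> \<open>The square is expanded over the complex numbers, so that the two mixed terms,
    conjugate to each other, can be integrated separately.\<close>
  have "complex_of_real ((cmod (f x - p x))\<^sup>2)
      = complex_of_real ((cmod (f x))\<^sup>2) - f x * cnj (p x) - cnj (f x * cnj (p x)) + p x * cnj (p x)" for x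
    unfolding complex_norm_square by (simp add: algebra_simps)
  then have "complex_of_real (LINT x|T. (cmod (f x - p x))\<^sup>2)
      = (LINT x|T. complex_of_real ((cmod (f x))\<^sup>2) - f x * cnj (p x) - cnj (f x * cnj (p x)) + p x * cnj (p x))"
    by (simp add: integral_complex_of_real[symmetric] del: of_real_power)
  also have "\<dots> = complex_of_real (LINT x|T. (cmod (f x))\<^sup>2) - V * S - V * S + V * S"
    using ff fp pf pf' pp
    by (simp add: integral_complex_of_real del: of_real_power complex_cnj_mult complex_cnj_cnj)
  also have "\<dots> = complex_of_real ((LINT x|T. (cmod (f x))\<^sup>2) - V * S)" by simp
  finally have "(LINT x|T. (cmod (f x - p x))\<^sup>2) = (LINT x|T. (cmod (f x))\<^sup>2) - V * S"
    by (simp only: of_real_eq_iff)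
  moreover have "(LINT x|T. (cmod (f x - p x))\<^sup>2) \<ge> 0" by simp
  ultimately have "V * S \<le> (LINT x|T. (cmod (f x))\<^sup>2)" by linarith
  then have "S \<le> (LINT x|T. (cmod (f x))\<^sup>2) / V" using V by (simp add: field_simps)
  then show ?thesis
    unfolding L2_set_def S_def c_def T_def V_def real_sqrt_divide[symmetric] by simp
qed

lemma fourier_coeff_L2_dist:
  assumes "f \<in> L2_torus \<omega>\<^sub>1 \<omega>\<^sub>2" "g \<in> L2_torus \<omega>\<^sub>1 \<omega>\<^sub>2" and "\<omega>\<^sub>1 > 0" "\<omega>\<^sub>2 > 0" and "finite L"
  shows "L2_set (\<lambda>k. cmod (fourier_coeff \<omega>\<^sub>1 \<omega>\<^sub>2 f k - fourier_coeff \<omega>\<^sub>1 \<omega>\<^sub>2 g k)) L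
    \<le> L2_dist \<omega>\<^sub>1 \<omega>\<^sub>2 f g / sqrt (\<omega>\<^sub>1 * \<omega>\<^sub>2)"
  using bessel_inequality[OF L2_torus_diff[OF assms(1,2)] assms(3-5)]
  by (simp add: fourier_coeff_diff[OF assms(1,2)] L2_dist_def)

section \<open>Continuity and local boundedness of the coefficients in time\<close>

lemma fourier_coeff_continuous:
  fixes \<psi> :: "real \<Rightarrow> real \<times> real \<Rightarrow> complex"
  assumes L2: "\<And>t. \<psi> t \<in> L2_torus \<omega>\<^sub>1 \<omega>\<^sub>2" and \<omega>: "\<omega>\<^sub>1 > 0" "\<omega>\<^sub>2 > 0"
    and cont: "\<And>t\<^sub>0. ((\<lambda>t. L2_dist \<omega>\<^sub>1 \<omega>\<^sub>2 (\<psi> t) (\<psi> t\<^sub>0)) \<longlongrightarrow> 0) (at t\<^sub>0)"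
  shows "continuous_on UNIV (\<lambda>t. fourier_coeff \<omega>\<^sub>1 \<omega>\<^sub>2 (\<psi> t) k)"
  unfolding continuous_on_def
proof
  fix t\<^sub>0 :: real
  have "((\<lambda>t. L2_dist \<omega>\<^sub>1 \<omega>\<^sub>2 (\<psi> t) (\<psi> t\<^sub>0) / sqrt (\<omega>\<^sub>1 * \<omega>\<^sub>2)) \<longlongrightarrow> 0) (at t\<^sub>0)"
    using tendsto_divide_zero[OF cont] .
  moreover have "cmod (fourier_coeff \<omega>\<^sub>1 \<omega>\<^sub>2 (\<psi> t) k - fourier_coeff \<omega>\<^sub>1 \<omega>\<^sub>2 (\<psi> t\<^sub>0) k)
      \<le> L2_dist \<omega>\<^sub>1 \<omega>\<^sub>2 (\<psi> t) (\<psi> t\<^sub>0) / sqrt (\<omega>\<^sub>1 * \<omega>\<^sub>2)" for t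
    using fourier_coeff_L2_dist[OF L2 L2 \<omega>, of "{k}"] by simp
  ultimately have "((\<lambda>t. fourier_coeff \<omega>\<^sub>1 \<omega>\<^sub>2 (\<psi> t) k - fourier_coeff \<omega>\<^sub>1 \<omega>\<^sub>2 (\<psi> t\<^sub>0) k) \<longlongrightarrow> 0) (at t\<^sub>0)"
    by (rule Lim_null_comparison[OF always_eventually[OF allI], rotated])
  then show "((\<lambda>t. fourier_coeff \<omega>\<^sub>1 \<omega>\<^sub>2 (\<psi> t) k) \<longlongrightarrow> fourier_coeff \<omega>\<^sub>1 \<omega>\<^sub>2 (\<psi> t\<^sub>0) k) (at t\<^sub>0)"
    by (simp add: LIM_zero_iff)
qed

text \<open>Compactness of the time interval: finitely many balls cover it on which the solution
  stays within L2 distance 1 of its value at the centre, and Bessel's inequality transfers this to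
  the coefficients.\<close>

lemma fourier_coeff_locally_bounded:
  fixes \<psi> :: "real \<Rightarrow> real \<times> real \<Rightarrow> complex"
  assumes L2: "\<And>t. \<psi> t \<in> L2_torus \<omega>\<^sub>1 \<omega>\<^sub>2" and \<omega>: "\<omega>\<^sub>1 > 0" "\<omega>\<^sub>2 > 0"
    and cont: "\<And>t\<^sub>0. ((\<lambda>t. L2_dist \<omega>\<^sub>1 \<omega>\<^sub>2 (\<psi> t) (\<psi> t\<^sub>0)) \<longlongrightarrow> 0) (at t\<^sub>0)"
  obtains K where "\<And>u L. \<bar>u\<bar> \<le> T \<Longrightarrow> finite L \<Longrightarrow> L2_set (\<lambda>k. cmod (fourier_coeff \<omega>\<^sub>1 \<omega>\<^sub>2 (\<psi> u) k)) L \<le> K"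
proof -
  define N where "N t = sqrt (LINT x|torus \<omega>\<^sub>1 \<omega>\<^sub>2. (cmod (\<psi> t x))\<^sup>2) / sqrt (\<omega>\<^sub>1 * \<omega>\<^sub>2)" for t
  define V where "V = sqrt (\<omega>\<^sub>1 * \<omega>\<^sub>2)"
  have V: "V > 0" using \<omega> by (simp add: V_def)
  have N0: "N t \<ge> 0" for t using \<omega> by (simp add: N_def)
  have "\<exists>\<delta>>0. \<forall>t. dist t t\<^sub>0 < \<delta> \<longrightarrow> L2_dist \<omega>\<^sub>1 \<omega>\<^sub>2 (\<psi> t) (\<psi> t\<^sub>0) \<le> 1" for t\<^sub>0
  proof -
    have "eventually (\<lambda>t. L2_dist \<omega>\<^sub>1 \<omega>\<^sub>2 (\<psi> t) (\<psi> t\<^sub>0) < 1) (at t\<^sub>0)"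
      using order_tendstoD(2)[OF cont] by simp
    then obtain \<delta> where \<delta>: "\<delta> > 0"
      "\<And>t. t \<noteq> t\<^sub>0 \<Longrightarrow> dist t t\<^sub>0 < \<delta> \<Longrightarrow> L2_dist \<omega>\<^sub>1 \<omega>\<^sub>2 (\<psi> t) (\<psi> t\<^sub>0) < 1"
      unfolding eventually_at by auto
    \<comment> \<open>The filter \<open>at\<close> leaves out the centre itself, which is added
      here.\<close>
    moreover have "L2_dist \<omega>\<^sub>1 \<omega>\<^sub>2 (\<psi> t\<^sub>0) (\<psi> t\<^sub>0) = 0" by (simp add: L2_dist_def)
    ultimately show ?thesis by (metis less_eq_real_def zero_le_one)
  qed
  then obtain \<delta> where \<delta>: "\<And>t\<^sub>0. \<delta> t\<^sub>0 > 0"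
    "\<And>t t\<^sub>0. dist t t\<^sub>0 < \<delta> t\<^sub>0 \<Longrightarrow> L2_dist \<omega>\<^sub>1 \<omega>\<^sub>2 (\<psi> t) (\<psi> t\<^sub>0) \<le> 1"
    by metis
  have "{-T..T} \<subseteq> (\<Union>t\<in>{-T..T}. ball t (\<delta> t))" using \<delta>(1) by (force intro: centre_in_ball[THEN iffD2])
  then obtain C where C: "C \<subseteq> {-T..T}" "finite C" "{-T..T} \<subseteq> (\<Union>t\<in>C. ball t (\<delta> t))"
    by (rule compactE_image[OF compact_Icc, rotated]) auto
  \<comment> \<open>The sum over the centres dominates each nonnegative \<open>N t\<close>; the
    distance of at most 1 to a centre costs \<open>1 / V\<close>.\<close>
  show ?thesis
  proof (rule that[of "(\<Sum>t\<in>C. N t) + 1 / V"])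
    fix u :: real and L :: "freq set"
    assume u: "\<bar>u\<bar> \<le> T" and L: "finite L"
    then have "u \<in> {-T..T}" by auto
    then obtain t where t: "t \<in> C" "dist u t < \<delta> t" using C(3) by (auto simp: dist_commute)
    have "L2_set (\<lambda>k. cmod (fourier_coeff \<omega>\<^sub>1 \<omega>\<^sub>2 (\<psi> u) k)) L
        \<le> L2_set (\<lambda>k. cmod (fourier_coeff \<omega>\<^sub>1 \<omega>\<^sub>2 (\<psi> t) k)
            + cmod (fourier_coeff \<omega>\<^sub>1 \<omega>\<^sub>2 (\<psi> u) k - fourier_coeff \<omega>\<^sub>1 \<omega>\<^sub>2 (\<psi> t) k)) L"
      by (intro L2_set_mono) (auto intro: norm_triangle_sub)
    also have "\<dots> \<le> L2_set (\<lambda>k. cmod (fourier_coeff \<omega>\<^sub>1 \<omega>\<^sub>2 (\<psi> t) k)) L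
        + L2_set (\<lambda>k. cmod (fourier_coeff \<omega>\<^sub>1 \<omega>\<^sub>2 (\<psi> u) k - fourier_coeff \<omega>\<^sub>1 \<omega>\<^sub>2 (\<psi> t) k)) L"
      by (rule L2_set_triangle_ineq)
    also have "\<dots> \<le> N t + L2_dist \<omega>\<^sub>1 \<omega>\<^sub>2 (\<psi> u) (\<psi> t) / V"
      unfolding N_def V_def
      by (intro add_mono bessel_inequality fourier_coeff_L2_dist L2 \<omega> L)
    also have "\<dots> \<le> (\<Sum>t\<in>C. N t) + 1 / V"
      using \<delta>(2)[OF t(2)] V C(2) t(1) N0
      by (intro add_mono divide_right_mono member_le_sum) auto
    finally show "L2_set (\<lambda>k. cmod (fourier_coeff \<omega>\<^sub>1 \<omega>\<^sub>2 (\<psi> u) k)) L \<le> (\<Sum>t\<in>C. N t) + 1 / V" .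
  qed
qed

subsection \<open>Conservation of mass\<close>

text \<open>The symmetry of \<open>Q\<close> under exchange of the two pairs makes the pairing of
  the cubic term with the solution real. The derivative of the mass is a multiple of the imaginary
  part of that pairing.\<close>

lemma finite_system_mass_conservation:
  fixes c :: "real \<Rightarrow> 'k \<Rightarrow> complex" and Q :: "'k \<Rightarrow> 'k \<Rightarrow> 'k \<Rightarrow> 'k \<Rightarrow> bool" and \<epsilon> t :: real
  defines "F \<equiv> \<lambda>B u k. \<Sum>k1\<in>B. \<Sum>k2\<in>B. \<Sum>k3\<in>B. if Q k1 k2 k3 k then c u k1 * c u k2 * cnj (c u k3) else 0"
  assumes B: "finite B"
    and sym: "\<And>k1 k2 k3 k4. Q k1 k2 k3 k4 \<longleftrightarrow> Q k3 k4 k1 k2"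
    and cont: "\<And>k. continuous_on UNIV (\<lambda>t. c t k)"
    and duhamel: "\<And>t k. k \<in> B \<Longrightarrow> c t k = cis (\<mu> k * t) * c0 k
        - \<i> * complex_of_real \<epsilon> * (LBINT u=ereal 0..ereal t. cis (\<mu> k * (t - u)) * F B u k)"
  shows "(\<Sum>k\<in>B. (cmod (c t k))\<^sup>2) = (\<Sum>k\<in>B. (cmod (c 0 k))\<^sup>2)"
proof -
  define G where "G k u = cis (- \<mu> k * u) * F B u k" for k u
  \<comment> \<open>The interaction representation removes the linear flow without changing moduli;
    the integrand \<open>G\<close> no longer depends on the end time, and \<phi> becomes
    differentiable.\<close>
  define \<phi> where "\<phi> k t = cis (- \<mu> k * t) * c t k" for k t
  have contF: "continuous_on X (\<lambda>u. F B u k)" for X k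
    unfolding F_def
  proof (intro continuous_on_sum)
    fix k1 k2 k3
    show "continuous_on X (\<lambda>u. if Q k1 k2 k3 k then c u k1 * c u k2 * cnj (c u k3) else 0)"
      by (cases "Q k1 k2 k3 k")
         (auto intro!: continuous_intros continuous_on_subset[OF cont])
  qed
  have contG: "continuous_on X (G k)" for X k
    unfolding G_def by (intro continuous_intros contF)
  have \<phi>: "\<phi> k t = c0 k - \<i> * complex_of_real \<epsilon> * (LBINT u=ereal 0..ereal t. G k u)" if "k \<in> B" for k t
  proof -
    have "(LBINT u=ereal 0..ereal t. cis (\<mu> k * (t - u)) * F B u k)
        = (LBINT u=ereal 0..ereal t. cis (\<mu> k * t) * G k u)"
      unfolding G_def by (simp add: cis_mult right_diff_distrib flip: mult.assoc)
    then have "c t k = cis (\<mu> k * t) * (c0 k - \<i> * complex_of_real \<epsilon> * (LBINT u=ereal 0..ereal t. G k u))"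
      using duhamel[OF that, of t] by (simp add: algebra_simps)
    then show ?thesis by (simp add: \<phi>_def cis_mult flip: mult.assoc)
  qed
  have \<phi>_deriv: "(\<phi> k has_vector_derivative - \<i> * complex_of_real \<epsilon> * G k t) (at t)" if "k \<in> B" for k t
  proof -
    \<comment> \<open>The interval contains 0 and has \<open>t\<close> in its interior, so the
      one-sided derivative at the boundary does not intervene.\<close>
    have "((\<lambda>t. LBINT u=ereal 0..ereal t. G k u) has_vector_derivative G k t)
        (at t within {- \<bar>t\<bar> - 1..\<bar>t\<bar> + 1})"
      by (rule interval_integral_FTC2) (auto intro: contG)
    then have "((\<lambda>t. LBINT u=ereal 0..ereal t. G k u) has_vector_derivative G k t) (at t)"
      by (simp add: at_within_Icc_at abs_if split: if_splits)
    then have "((\<lambda>t. c0 k - \<i> * complex_of_real \<epsilon> * (LBINT u=ereal 0..ereal t. G k u))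
        has_vector_derivative 0 - \<i> * complex_of_real \<epsilon> * G k t) (at t)"
      by (intro has_vector_derivative_diff has_vector_derivative_const has_vector_derivative_mult_right)
    then show ?thesis unfolding \<phi>[OF that, abs_def] by simp
  qed
  have real: "cnj (\<Sum>k\<in>B. F B t k * cnj (c t k)) = (\<Sum>k\<in>B. F B t k * cnj (c t k))" for t
  proof -
    define h where "h = (\<lambda>(k4, k1, k2, k3). if Q k1 k2 k3 k4 then c t k1 * c t k2 * cnj (c t k3) * cnj (c t k4) else 0)"
    have eq: "(\<Sum>k\<in>B. F B t k * cnj (c t k)) = sum h (B \<times> B \<times> B \<times> B)"
      by (simp add: F_def h_def sum_distrib_right if_distribR flip: sum.cartesian_product cong: if_cong)
         (auto intro!: sum.cong)
    \<comment> \<open>The reindexing exchanges \<open>(k1, k2)\<close> with \<open>(k3, k4)\<close>;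
      it is an involution that turns each summand into its conjugate.\<close>
    have "(\<Sum>x\<in>B \<times> B \<times> B \<times> B. cnj (h x)) = sum h (B \<times> B \<times> B \<times> B)"
      by (rule sum.reindex_bij_witness[where i = "\<lambda>(k4, k1, k2, k3). (k2, k3, k4, k1)"
            and j = "\<lambda>(k4, k1, k2, k3). (k2, k3, k4, k1)"])
         (auto simp: h_def sym mult_ac)
    then show ?thesis unfolding eq by (simp add: cnj_sum)
  qed
  define E where "E t = (\<Sum>k\<in>B. \<phi> k t * cnj (\<phi> k t))" for t
  have "(E has_vector_derivative 0) (at t within UNIV)" for t
  proof -
    define S where "S = (\<Sum>k\<in>B. F B t k * cnj (c t k))"
    have "(E has_vector_derivative
        (\<Sum>k\<in>B. \<phi> k t * cnj (- \<i> * complex_of_real \<epsilon> * G k t) + - \<i> * complex_of_real \<epsilon> * G k t * cnj (\<phi> k t))) (at t)"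
      unfolding E_def
      by (intro has_vector_derivative_sum has_vector_derivative_mult has_vector_derivative_cnj \<phi>_deriv)
    also have "(\<Sum>k\<in>B. \<phi> k t * cnj (- \<i> * complex_of_real \<epsilon> * G k t) + - \<i> * complex_of_real \<epsilon> * G k t * cnj (\<phi> k t))
        = (\<Sum>k\<in>B. \<i> * complex_of_real \<epsilon> * cnj (F B t k * cnj (c t k)) - \<i> * complex_of_real \<epsilon> * (F B t k * cnj (c t k)))"
    proof (intro sum.cong refl)
      fix k
      have "cis (- \<mu> k * t) * cnj (cis (- \<mu> k * t)) = 1" by (simp add: cis_cnj cis_mult)
      then have "G k t * cnj (\<phi> k t) = F B t k * cnj (c t k)"
        unfolding G_def \<phi>_def by (simp add: algebra_simps)
      moreover from this have "\<phi> k t * cnj (G k t) = cnj (F B t k * cnj (c t k))"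
        by (metis complex_cnj_cnj complex_cnj_mult mult.commute)
      ultimately show "\<phi> k t * cnj (- \<i> * complex_of_real \<epsilon> * G k t) + - \<i> * complex_of_real \<epsilon> * G k t * cnj (\<phi> k t)
        = \<i> * complex_of_real \<epsilon> * cnj (F B t k * cnj (c t k)) - \<i> * complex_of_real \<epsilon> * (F B t k * cnj (c t k))"
        by (simp add: algebra_simps)
    qed
    also have "\<dots> = \<i> * complex_of_real \<epsilon> * (cnj S - S)"
      unfolding S_def by (simp add: sum_subtractf cnj_sum right_diff_distrib flip: sum_distrib_left)
    also have "\<dots> = 0" using real[of t] by (simp add: S_def)
    finally show ?thesis by simp
  qed
  then obtain e where "\<And>t. E t = e"
    using has_vector_derivative_zero_constant[of UNIV E] by auto
  then have "E t = E 0" by simp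
  moreover have "E t = complex_of_real (\<Sum>k\<in>B. (cmod (c t k))\<^sup>2)" for t
  proof -
    have "\<phi> k t * cnj (\<phi> k t) = complex_of_real ((cmod (c t k))\<^sup>2)" for k
      unfolding complex_norm_square[symmetric] by (simp add: \<phi>_def norm_mult)
    then show ?thesis by (simp add: E_def)
  qed
  ultimately show ?thesis by (simp only: of_real_eq_iff)
qed

section \<open>Confinement to a finite box of frequencies and the uniform Sobolev bound\<close>

theorem theorem3:
  fixes \<omega>\<^sub>1 \<omega>\<^sub>2 \<Lambda> \<tau> \<epsilon> s :: real
    and \<psi>\<^sub>0 :: "real \<times> real \<Rightarrow> complex"
    and \<psi> :: "real \<Rightarrow> real \<times> real \<Rightarrow> complex"
  assumes "generic_irrational_pair \<omega>\<^sub>1 \<omega>\<^sub>2"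
    and "\<Lambda> > 0" and "\<tau> > 1"
    and "\<epsilon> \<in> {1, -1}"
    and "\<psi>\<^sub>0 \<in> L2_torus \<omega>\<^sub>1 \<omega>\<^sub>2"
    and "finite {k. fourier_coeff \<omega>\<^sub>1 \<omega>\<^sub>2 \<psi>\<^sub>0 k \<noteq> 0}"
    and "is_global_solution \<omega>\<^sub>1 \<omega>\<^sub>2 \<Lambda> \<tau> \<epsilon> \<psi>\<^sub>0 \<psi>"
    and "s > 1"
  shows "(\<forall>t. \<psi> t \<in> sobolev_space \<omega>\<^sub>1 \<omega>\<^sub>2 s) \<and>
         bdd_above (range (\<lambda>t. sobolev_norm \<omega>\<^sub>1 \<omega>\<^sub>2 s (\<psi> t)))"
proof -
  have \<omega>: "\<omega>\<^sub>1 > 0" "\<omega>\<^sub>2 > 0" using assms(1) by (auto simp: generic_irrational_pair_def)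
  have \<epsilon>: "\<bar>\<epsilon>\<bar> = 1" using assms(4) by auto
  define c where "c t = fourier_coeff \<omega>\<^sub>1 \<omega>\<^sub>2 (\<psi> t)" for t
  define c0 where "c0 = fourier_coeff \<omega>\<^sub>1 \<omega>\<^sub>2 \<psi>\<^sub>0"
  define \<mu> where "\<mu> = eigenval \<omega>\<^sub>1 \<omega>\<^sub>2"
  define Q where "Q = quasi_resonant \<omega>\<^sub>1 \<omega>\<^sub>2 \<Lambda> \<tau>"
  define R where "R k = {(k1, k2, k3). Q k1 k2 k3 k}" for k
  define F where "F u k = (\<Sum>\<^sub>\<infinity>(k1, k2, k3)\<in>R k. c u k1 * c u k2 * cnj (c u k3))" for u k
  have L2: "\<psi> t \<in> L2_torus \<omega>\<^sub>1 \<omega>\<^sub>2" for t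
    using assms(7) by (simp add: is_global_solution_def)
  have L2_cont: "((\<lambda>t. L2_dist \<omega>\<^sub>1 \<omega>\<^sub>2 (\<psi> t) (\<psi> t\<^sub>0)) \<longlongrightarrow> 0) (at t\<^sub>0)" for t\<^sub>0
    using assms(7) by (simp add: is_global_solution_def)
  have duhamel: "c t k = cis (\<mu> k * t) * c0 k
      - \<i> * complex_of_real \<epsilon> * (LBINT u=ereal 0..ereal t. cis (\<mu> k * (t - u)) * F u k)" for t k
    using assms(7)
    unfolding is_global_solution_def restricted_cubic_coeff_def c_def c0_def \<mu>_def F_def R_def Q_def
    by blast
  obtain N1 :: nat where rect: "\<And>k1 k2 k3 m l. Q k1 k2 k3 (m, l) \<Longrightarrow>
      \<bar>m\<bar> > int N1 \<or> \<bar>l\<bar> > int N1 \<Longrightarrow> is_rectangle k1 k2 k3 (m, l)"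
    using quasi_resonant_imp_is_rectangle[of \<omega>\<^sub>1 \<omega>\<^sub>2 \<Lambda> \<tau>] assms unfolding Q_def by auto
  \<comment> \<open>\<open>X\<close> collects both coordinates of all initial frequencies. The sum
    in \<open>N\<close> dominates each of their moduli, and \<open>N\<close> is at least the
    rectangle threshold \<open>N1\<close>.\<close>
  define X where "X = fst ` {k. c0 k \<noteq> 0} \<union> snd ` {k. c0 k \<noteq> 0}"
  have finX: "finite X" using assms(6) unfolding X_def c0_def by blast
  define N where "N = int N1 + (\<Sum>a\<in>X. \<bar>a\<bar>)"
  have N1: "int N1 \<le> N" unfolding N_def by (simp add: sum_nonneg)
  have "a \<in> X \<Longrightarrow> \<bar>a\<bar> \<le> N" for a
    using member_le_sum[of a X abs] finX unfolding N_def by simp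
  then have c0: "c0 (m, l) = 0" if "\<bar>m\<bar> > N \<or> \<bar>l\<bar> > N" for m l
    using that unfolding X_def by force
  have c_row: "c t (m, l) = 0" if m: "\<bar>m\<bar> > N" for t m l
  proof -
    \<comment> \<open>The bound \<open>K\<close> may grow with \<open>t\<close>, but the Gronwall
      argument yields exact vanishing, and the row threshold \<open>N\<close> does not depend on
      time.\<close>
    obtain K where K: "\<And>u L. \<bar>u\<bar> \<le> \<bar>t\<bar> \<Longrightarrow> finite L \<Longrightarrow> L2_set (\<lambda>k. cmod (c u k)) L \<le> K"
      using fourier_coeff_locally_bounded[where T = "\<bar>t\<bar>" and \<psi> = \<psi>, OF L2 \<omega> L2_cont]
      unfolding c_def by blast
    show ?thesis
    proof (rule duhamel_gronwall[where g = "\<lambda>t l. c t (m, l)" and G = "\<lambda>u l. F u (m, l)"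
          and \<mu> = "\<lambda>l. \<mu> (m, l)" and \<epsilon> = \<epsilon> and T = "\<bar>t\<bar>" and S = K and D = "4 * K\<^sup>2"])
      show "c t (m, l) = - (\<i> * complex_of_real \<epsilon> *
          (LBINT u=ereal 0..ereal t. cis (\<mu> (m, l) * (t - u)) * F u (m, l)))" for t l
        using duhamel[of t "(m, l)"] c0[of m l] m by simp
    next
      fix u L assume "\<bar>u\<bar> \<le> \<bar>t\<bar>" "finite (L :: int set)"
      then show "L2_set (\<lambda>l. cmod (c u (m, l))) L \<le> K"
        using K[of u "Pair m ` L"] by (simp add: L2_set_def sum.reindex inj_on_def)
    next
      fix u r L
      assume "\<bar>u\<bar> \<le> \<bar>t\<bar>" and "\<And>L. finite L \<Longrightarrow> L2_set (\<lambda>l. cmod (c u (m, l))) L \<le> r"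
        and "finite (L :: int set)"
      then show "L2_set (\<lambda>l. cmod (F u (m, l))) L \<le> 4 * K\<^sup>2 * r"
        unfolding F_def using K rect m N1
        by (intro rectangle_sum_row_bound[where m = m]) (auto simp: R_def)
    qed (use \<epsilon> in auto)
  qed
  have c_col: "c t (m, l) = 0" if l: "\<bar>l\<bar> > N" for t m l
  proof -
    obtain K where K: "\<And>u L. \<bar>u\<bar> \<le> \<bar>t\<bar> \<Longrightarrow> finite L \<Longrightarrow> L2_set (\<lambda>k. cmod (c u k)) L \<le> K"
      using fourier_coeff_locally_bounded[where T = "\<bar>t\<bar>" and \<psi> = \<psi>, OF L2 \<omega> L2_cont]
      unfolding c_def by blast
    show ?thesis
    proof (rule duhamel_gronwall[where g = "\<lambda>t m. c t (m, l)" and G = "\<lambda>u m. F u (m, l)"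
          and \<mu> = "\<lambda>m. \<mu> (m, l)" and \<epsilon> = \<epsilon> and T = "\<bar>t\<bar>" and S = K and D = "4 * K\<^sup>2"])
      show "c t (m, l) = - (\<i> * complex_of_real \<epsilon> *
          (LBINT u=ereal 0..ereal t. cis (\<mu> (m, l) * (t - u)) * F u (m, l)))" for t m
        using duhamel[of t "(m, l)"] c0[of m l] l by simp
    next
      fix u L assume "\<bar>u\<bar> \<le> \<bar>t\<bar>" "finite (L :: int set)"
      then show "L2_set (\<lambda>m. cmod (c u (m, l))) L \<le> K"
        using K[of u "(\<lambda>m. (m, l)) ` L"] by (simp add: L2_set_def sum.reindex inj_on_def)
    next
      fix u r L
      assume "\<bar>u\<bar> \<le> \<bar>t\<bar>" and "\<And>L. finite L \<Longrightarrow> L2_set (\<lambda>m. cmod (c u (m, l))) L \<le> r"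
        and "finite (L :: int set)"
      then show "L2_set (\<lambda>m. cmod (F u (m, l))) L \<le> 4 * K\<^sup>2 * r"
        unfolding F_def using K rect l N1
        by (intro rectangle_sum_col_bound[where l = l]) (auto simp: R_def)
    qed (use \<epsilon> in auto)
  qed
  define B where "B = {- N..N} \<times> {- N..N}"
  have B: "finite B" by (simp add: B_def)
  have supp: "c t k = 0" if "k \<notin> B" for t k
  proof (cases k)
    case (Pair m l)
    then have "\<bar>m\<bar> > N \<or> \<bar>l\<bar> > N" using that by (auto simp: B_def)
    then show ?thesis using Pair c_row c_col by blast
  qed
  have in_B: "k \<in> B" if "c t k \<noteq> 0" for t k using supp that by blast
  \<comment> \<open>As all coefficients vanish outside \<open>B\<close>, the infinite cubic sum is a
    finite one and the modes in \<open>B\<close> form a closed finite system.\<close>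
  have F_B: "F u k = (\<Sum>k1\<in>B. \<Sum>k2\<in>B. \<Sum>k3\<in>B. if Q k1 k2 k3 k then c u k1 * c u k2 * cnj (c u k3) else 0)" for u k
  proof -
    have "F u k = (\<Sum>\<^sub>\<infinity>(k1, k2, k3)\<in>B \<times> B \<times> B. if Q k1 k2 k3 k then c u k1 * c u k2 * cnj (c u k3) else 0)"
      unfolding F_def by (rule infsum_cong_neutral) (auto simp: R_def supp intro: in_B)
    then show ?thesis using B by (simp add: sum.cartesian_product)
  qed
  \<comment> \<open>Exchanging the pairs only changes the sign of the eigenvalue combination inside
    the modulus; this is the symmetry that mass conservation uses.\<close>
  have sym: "Q k1 k2 k3 k4 \<longleftrightarrow> Q k3 k4 k1 k2" for k1 k2 k3 k4
  proof -
    have "k1 + k2 - k3 - k4 = 0 \<longleftrightarrow> k3 + k4 - k1 - k2 = 0"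
      by (auto simp: algebra_simps)
    moreover have "\<bar>\<mu> k1 + \<mu> k2 - \<mu> k3 - \<mu> k4\<bar> = \<bar>\<mu> k3 + \<mu> k4 - \<mu> k1 - \<mu> k2\<bar>" by linarith
    moreover have "freq_sq k1 + freq_sq k2 + freq_sq k3 + freq_sq k4 = freq_sq k3 + freq_sq k4 + freq_sq k1 + freq_sq k2"
      by simp
    ultimately show ?thesis unfolding Q_def quasi_resonant_def \<mu>_def by metis
  qed
  define E where "E = (\<Sum>k\<in>B. (cmod (c 0 k))\<^sup>2)"
  have mass: "(\<Sum>k\<in>B. (cmod (c t k))\<^sup>2) = E" for t
    unfolding E_def
  proof (rule finite_system_mass_conservation[where c = c and \<epsilon> = \<epsilon> and \<mu> = \<mu> and Q = Q and ?c0.0 = c0])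
    show "continuous_on UNIV (\<lambda>t. c t k)" for k
      unfolding c_def by (rule fourier_coeff_continuous[OF L2 \<omega> L2_cont])
  qed (use B sym duhamel F_B in auto)
  define w where "w k = (1 + freq_sq k) powr s" for k
  have summ: "(\<lambda>k. (cmod (c t k))\<^sup>2 * w k) summable_on UNIV" for t
    using summable_on_cong_neutral[of B UNIV "\<lambda>k. (cmod (c t k))\<^sup>2 * w k" "\<lambda>k. (cmod (c t k))\<^sup>2 * w k"]
      summable_on_finite[OF B] by (simp add: supp)
  \<comment> \<open>Each square modulus is at most the conserved mass \<open>E\<close>, and only the
    weights on the fixed set \<open>B\<close> occur, so the bound is the same for all times.\<close>
  have norm: "sobolev_norm \<omega>\<^sub>1 \<omega>\<^sub>2 s (\<psi> t) \<le> sqrt (\<Sum>k\<in>B. E * w k)" for t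
  proof -
    have "(\<Sum>\<^sub>\<infinity>k. (cmod (c t k))\<^sup>2 * w k) = (\<Sum>\<^sub>\<infinity>k\<in>B. (cmod (c t k))\<^sup>2 * w k)"
      by (rule infsum_cong_neutral) (auto simp: supp)
    also have "\<dots> = (\<Sum>k\<in>B. (cmod (c t k))\<^sup>2 * w k)" using B by simp
    also have "\<dots> \<le> (\<Sum>k\<in>B. E * w k)"
    proof (intro sum_mono mult_right_mono)
      fix k assume "k \<in> B"
      then show "(cmod (c t k))\<^sup>2 \<le> E"
        unfolding mass[of t, symmetric] using B by (intro member_le_sum) auto
    qed (simp add: w_def)
    finally show ?thesis unfolding sobolev_norm_def c_def w_def by simp
  qed
  show ?thesis
  proof
    show "\<forall>t. \<psi> t \<in> sobolev_space \<omega>\<^sub>1 \<omega>\<^sub>2 s"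
      using L2 summ unfolding sobolev_space_def c_def w_def by blast
    show "bdd_above (range (\<lambda>t. sobolev_norm \<omega>\<^sub>1 \<omega>\<^sub>2 s (\<psi> t)))"
      using norm by (rule bdd_aboveI2)
  qed
qed

end
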